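(* Let $T$ be a circle map $T(x)=x(1+V(x)) \bmod 1$ as described in the context. Let $\omega$ and $\Omega$ be moduli of continuity such that $\Omega$ is $T$-compatible with respect to $\omega$, and assume that $\Omega$ is concave and vanishes orderly. Let $f\in\mathscr C_\omega(\mathbb T)$ and let $d\mu=h\,d\nu$ be the associated equilibrium state. Then there exists $\rho\in(0,1)$ such that, given $\phi,\psi\in\mathscr C_\Omega(\mathbb T)$, there is a constant $K=K(\phi,\psi)>0$ for which $$\Big|\int\phi\;\psi\circ T^n\,d\mu-\int\phi\,d\mu\int\psi\,d\mu\Big|\le K\rho^n\qquad\text{for all } n\ge1.$$
   Context: Phase space and dynamics: $\mathbb T=[0,1)$ is the circle with metric $d(x,y)=\min\{|x-y|,|x-y\pm1|\}$. $T:\mathbb T\to\mathbb T$ is the continuous map $T(x)=x(1+V(x)) \bmod 1$, where $V:[0,\infty)\to[0,\infty)$ is continuous and increasing, $V(1)$ is a positive integer, and $V$ is regularly varying at $0$: there is $\sigma\ge0$ with $\lim_{x\to0}V(tx)/V(x)=t^\sigma$ for all $t>0$. Moduli of continuity: a modulus of continuity is a continuous non-decreasing function $\omega:[0,\infty)\to[0,\infty)$ with $\omega(0)=0$ (and $\omega(t)>0$ for $t>0$, so that the quotients below make sense). $|f|_\omega:=\sup_{x\ne y}|f(x)-f(y)|/\omega(d(x,y))$, and $\mathscr C_\omega(\mathbb T)$ is the space of real-valued continuous functions $f$ on $\mathbb T$ with $|f|_\omega<\infty$. $T$-compatibility: a pre-orbit of $x_0$ is a sequence $\{x_k\}_{k\ge0}$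 with $T(x_{k+1})=x_k$ for all $k$. $\Omega$ is $T$-compatible with respect to $\omega$ if there are constants $\varrho_1,C_1>0$ such that, for any $x_0,y_0$ with $d(x_0,y_0)<\varrho_1$, there is a bijection between the pre-orbits $\{x_k\}$ of $x_0$ and the pre-orbits $\{y_k\}$ of $y_0$ such that corresponding pre-orbits satisfy, for all $k$, $d(x_k,y_k)\le d(x_0,y_0)<\varrho_1$ and $C_1\sum_{j=1}^k\omega(d(x_j,y_j))\le\Omega(d(x_0,y_0))-\Omega(d(x_k,y_k))$. $\Omega$ vanishes orderly if $\lim_{x\to0^+}\sup_{0<\mathsf d<1/2}\Omega(\mathsf d x)/\Omega(\mathsf d)=0$. Transfer operator and equilibrium state: $\mathscr L_f\phi(x)=\sum_{y\in T^{-1}(x)}e^{f(y)}\phi(y)$. Known fact (Ruelle-Perron-Frobenius theorem from earlier work): if $\Omega$ is $T$-compatible with respect to $\omega$ and $f\in\mathscr C_\omega(\mathbb T)$, there are $\chi>0$ (the maximal eigenvalue), a strictly positive $h\in\mathscr C_\Omega(\mathbb T)$ and a Borel probability measure $\nu$ with $\mathscr L_fh=\chi h$, $\mathscr L_f^*\nu=\chi\nu$, $\int h\,d\nu=1$, and $\chi^{-n}\mathscr L_f^n\psi\to h\int\psi\,d\nu$ uniformly for every continuous $\psi$. The $T$-invariant probability $d\mu=h\,d\nu$ is the unique equilibrium state of $f$, i.e. the unique $T$-invariant Borel probability $m$ maximizing $h_m(T)+\int f\,dm$, where $h_m(T)$ is the Kolmogorov-Sinai entropy. *)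

theory Defs
  imports "HOL-Probability.Probability"
begin

section \<open>The circle\<close>

typedef circle = "{0..<1::real}"
  morphisms coord Abs_circle
  by (rule exI[of _ 0]) simp

instantiation circle :: metric_space
begin

definition dist_circle :: "circle \<Rightarrow> circle \<Rightarrow> real" where
  "dist_circle x y =
     Min {\<bar>coord x - coord y\<bar>, \<bar>coord x - coord y + 1\<bar>, \<bar>coord x - coord y - 1\<bar>}"

definition uniformity_circle :: "(circle \<times> circle) filter" where
  "uniformity_circle = (INF e\<in>{0<..}. principal {(x, y). dist x y < e})"

definition open_circle :: "circle set \<Rightarrow> bool" where
  "open_circle U = (\<forall>x\<in>U. eventually (\<lambda>(x', y). x' = x \<longrightarrow> y \<in> U) uniformity)"

instance
proof
  fix x y z :: circle
  have c: "0 \<le> coord w" "coord w < 1" for w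
    using coord[of w] by auto
  have "dist x y = 0 \<longleftrightarrow> coord x = coord y"
    using c[of x] c[of y] unfolding dist_circle_def by (auto simp: min_def)
  then show "dist x y = 0 \<longleftrightarrow> x = y"
    by (simp add: coord_inject)
  show "dist x y \<le> dist x z + dist y z"
    using c[of x] c[of y] c[of z] unfolding dist_circle_def
    by (simp add: min_def abs_if)
qed (simp_all add: uniformity_circle_def open_circle_def)

end


section \<open>The dynamics\<close>

definition regularly_varying_at_0 :: "(real \<Rightarrow> real) \<Rightarrow> bool" where
  "regularly_varying_at_0 V \<longleftrightarrow>
     (\<exists>\<sigma>\<ge>0. \<forall>t>0. ((\<lambda>x. V (t * x) / V x) \<longlongrightarrow> t powr \<sigma>) (at_right 0))"

definition admissible :: "(real \<Rightarrow> real) \<Rightarrow> bool" where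
  "admissible V \<longleftrightarrow>
     continuous_on {0..} V \<and> strict_mono_on {0..} V \<and> (\<forall>x\<ge>0. 0 \<le> V x) \<and>
     (\<exists>N::nat. 0 < N \<and> V 1 = real N) \<and> regularly_varying_at_0 V"

definition circle_map :: "(real \<Rightarrow> real) \<Rightarrow> circle \<Rightarrow> circle" where
  "circle_map V x = Abs_circle (frac (coord x * (1 + V (coord x))))"


section \<open>Moduli of continuity\<close>

definition modulus_of_continuity :: "(real \<Rightarrow> real) \<Rightarrow> bool" where
  "modulus_of_continuity \<omega> \<longleftrightarrow>
     continuous_on {0..} \<omega> \<and> mono_on {0..} \<omega> \<and> \<omega> 0 = 0 \<and> (\<forall>t>0. 0 < \<omega> t)"

definition modulus_seminorm :: "(real \<Rightarrow> real) \<Rightarrow> ('a::metric_space \<Rightarrow> real) \<Rightarrow> ereal" where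
  "modulus_seminorm \<omega> f =
     (SUP (x, y)\<in>{(x, y). x \<noteq> y}. ereal (\<bar>f x - f y\<bar> / \<omega> (dist x y)))"

definition modulus_space :: "(real \<Rightarrow> real) \<Rightarrow> ('a::metric_space \<Rightarrow> real) set" where
  "modulus_space \<omega> = {f. continuous_on UNIV f \<and> modulus_seminorm \<omega> f < \<infinity>}"

definition pre_orbits :: "('a \<Rightarrow> 'a) \<Rightarrow> 'a \<Rightarrow> (nat \<Rightarrow> 'a) set" where
  "pre_orbits T x0 = {x. x 0 = x0 \<and> (\<forall>k. T (x (Suc k)) = x k)}"

definition compatible ::
    "('a::metric_space \<Rightarrow> 'a) \<Rightarrow> (real \<Rightarrow> real) \<Rightarrow> (real \<Rightarrow> real) \<Rightarrow> bool" where
  "compatible T \<Omega> \<omega> \<longleftrightarrow>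
     (\<exists>\<rho>1>0. \<exists>C1>0. \<forall>x0 y0. dist x0 y0 < \<rho>1 \<longrightarrow>
        (\<exists>\<beta>. bij_betw \<beta> (pre_orbits T x0) (pre_orbits T y0) \<and>
           (\<forall>x\<in>pre_orbits T x0. \<forall>k.
              dist (x k) (\<beta> x k) \<le> dist x0 y0 \<and>
              C1 * (\<Sum>j=1..k. \<omega> (dist (x j) (\<beta> x j)))
                \<le> \<Omega> (dist x0 y0) - \<Omega> (dist (x k) (\<beta> x k)))))"

definition vanishes_orderly :: "(real \<Rightarrow> real) \<Rightarrow> bool" where
  "vanishes_orderly \<Omega> \<longleftrightarrow>
     ((\<lambda>x. SUP d\<in>{0<..<1/2}. ereal (\<Omega> (d * x) / \<Omega> d)) \<longlongrightarrow> 0) (at_right 0)"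


section \<open>The transfer operator\<close>

definition transfer_operator ::
    "('a \<Rightarrow> 'a) \<Rightarrow> ('a \<Rightarrow> real) \<Rightarrow> ('a \<Rightarrow> real) \<Rightarrow> 'a \<Rightarrow> real" where
  "transfer_operator T f \<phi> x = (\<Sum>y\<in>T -` {x}. exp (f y) * \<phi> y)"

text \<open>The sum in \<^const>\<open>transfer_operator\<close> is a genuine finite sum for the maps considered here.\<close>

lemma finite_circle_map_preimage:
  assumes "admissible V"
  shows "finite (circle_map V -` {x})"
proof -
  define g where "g = (\<lambda>r. r * (1 + V r))"
  have sm: "V r < V s" if "0 \<le> r" "r < s" for r s
    using assms that by (auto simp: admissible_def strict_mono_on_def)
  have nn: "0 \<le> V r" if "0 \<le> r" for r
    using assms that by (auto simp: admissible_def)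
  have c: "0 \<le> coord w" "coord w < 1" for w
    using coord[of w] by auto
  have gmono: "g r < g s" if "0 \<le> r" "r < s" for r s
    unfolding g_def using sm[OF that] nn[of r] that
    by (intro mult_strict_mono) auto
  have rep: "coord (circle_map V y) = frac (g (coord y))" for y
    unfolding circle_map_def g_def
    by (rule Abs_circle_inverse) (simp add: frac_lt_1)
  have "inj_on (\<lambda>y. \<lfloor>g (coord y)\<rfloor>) (circle_map V -` {x})"
  proof (rule inj_onI)
    fix y z assume a: "y \<in> circle_map V -` {x}" "z \<in> circle_map V -` {x}"
      and e: "\<lfloor>g (coord y)\<rfloor> = \<lfloor>g (coord z)\<rfloor>"
    have "frac (g (coord y)) = frac (g (coord z))"
      using a rep[of y] rep[of z] by simp
    with e have "g (coord y) = g (coord z)"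
      by (simp add: frac_def)
    then have "coord y = coord z"
      using gmono[of "coord y" "coord z"] gmono[of "coord z" "coord y"] c[of y] c[of z]
      by (cases "coord y" "coord z" rule: linorder_cases) auto
    then show "y = z" by (simp add: coord_inject)
  qed
  moreover have "(\<lambda>y. \<lfloor>g (coord y)\<rfloor>) ` (circle_map V -` {x}) \<subseteq> {0..\<lfloor>g 1\<rfloor>}"
  proof clarify
    fix y
    have "0 \<le> g (coord y)" using c[of y] nn[of "coord y"] by (simp add: g_def)
    moreover have "g (coord y) \<le> g 1" using gmono[of "coord y" 1] c[of y] by simp
    ultimately show "\<lfloor>g (coord y)\<rfloor> \<in> {0..\<lfloor>g 1\<rfloor>}" by (simp add: floor_mono)
  qed
  ultimately show ?thesis
    by (meson finite_atLeastAtMost_int finite_imageD finite_subset)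
qed

text \<open>The data of the Ruelle--Perron--Frobenius theorem. The dual eigenvalue equation for the
  measure is expressed by duality with continuous functions.\<close>

definition rpf_data ::
    "('a::metric_space \<Rightarrow> 'a) \<Rightarrow> (real \<Rightarrow> real) \<Rightarrow> ('a \<Rightarrow> real) \<Rightarrow>
     real \<Rightarrow> ('a \<Rightarrow> real) \<Rightarrow> 'a measure \<Rightarrow> bool" where
  "rpf_data T \<Omega> f \<kappa> h \<nu> \<longleftrightarrow>
     0 < \<kappa> \<and>
     h \<in> modulus_space \<Omega> \<and> (\<forall>x. 0 < h x) \<and>
     prob_space \<nu> \<and> sets \<nu> = sets borel \<and>
     transfer_operator T f h = (\<lambda>x. \<kappa> * h x) \<and>
     (\<forall>\<psi>. continuous_on UNIV \<psi> \<longrightarrow>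
        (\<integral>x. transfer_operator T f \<psi> x \<partial>\<nu>) = \<kappa> * (\<integral>x. \<psi> x \<partial>\<nu>)) \<and>
     (\<integral>x. h x \<partial>\<nu>) = 1 \<and>
     (\<forall>\<psi>. continuous_on UNIV \<psi> \<longrightarrow>
        uniform_limit UNIV (\<lambda>n x. (transfer_operator T f ^^ n) \<psi> x / \<kappa> ^ n)
          (\<lambda>x. h x * (\<integral>y. \<psi> y \<partial>\<nu>)) sequentially)"


section \<open>Entropy and equilibrium states\<close>

definition invariant_prob :: "('a::topological_space \<Rightarrow> 'a) \<Rightarrow> 'a measure \<Rightarrow> bool" where
  "invariant_prob T m \<longleftrightarrow> prob_space m \<and> sets m = sets borel \<and> distr m borel T = m"

definition partition_entropy :: "'a measure \<Rightarrow> 'a set set \<Rightarrow> real" where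
  "partition_entropy m P = - (\<Sum>A\<in>P. measure m A * ln (measure m A))"

text \<open>The common refinement of the preimages of \<open>P\<close> under the first \<open>n\<close> iterates.\<close>

definition refined_partition :: "('a \<Rightarrow> 'a) \<Rightarrow> 'a set set \<Rightarrow> nat \<Rightarrow> 'a set set" where
  "refined_partition T P n =
     {\<Inter>i<n. (T ^^ i) -` A i | A. \<forall>i<n. A i \<in> P} - {{}}"

definition ks_entropy :: "('a::topological_space \<Rightarrow> 'a) \<Rightarrow> 'a measure \<Rightarrow> ereal" where
  "ks_entropy T m =
     (SUP P\<in>{P. finite P \<and> partition_on UNIV P \<and> P \<subseteq> sets borel}.
        lim (\<lambda>n. ereal (partition_entropy m (refined_partition T P n) / real n)))"

definition equilibrium_state ::
    "('a::topological_space \<Rightarrow> 'a) \<Rightarrow> ('a \<Rightarrow> real) \<Rightarrow> 'a measure \<Rightarrow> bool" where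
  "equilibrium_state T f m \<longleftrightarrow>
     invariant_prob T m \<and>
     (\<forall>m'. invariant_prob T m' \<longrightarrow>
        ks_entropy T m' + ereal (\<integral>x. f x \<partial>m') \<le> ks_entropy T m + ereal (\<integral>x. f x \<partial>m))"

definition unique_equilibrium_state ::
    "('a::topological_space \<Rightarrow> 'a) \<Rightarrow> ('a \<Rightarrow> real) \<Rightarrow> 'a measure \<Rightarrow> bool" where
  "unique_equilibrium_state T f m \<longleftrightarrow>
     equilibrium_state T f m \<and> (\<forall>m'. equilibrium_state T f m' \<longrightarrow> m' = m)"

end

theory Submission
  imports Defs
begin

text \<open>
  With \<open>g = f + ln h - ln (h \<circ> T) - ln \<kappa>\<close> the transfer operator \<open>L\<close> of \<open>g\<close> fixes the
  constants and contracts the supremum norm. Compatibility pairs the preimages of two nearby points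
  \<open>x\<close>, \<open>y\<close> so that no pair is further apart than \<open>x\<close> and \<open>y\<close>. The pair near the neutral fixed point
  may not contract at all, but some other pair contracts by a fixed factor \<open>l < 1\<close> and carries a
  weight \<open>exp (g z)\<close> bounded from below. Concavity and orderly vanishing turn \<open>l\<close> into
  \<open>\<Omega> (l d) \<le> (1 - c) \<Omega> d\<close> for small \<open>d\<close>, which gives a Lasota--Yorke inequality for the
  \<open>\<Omega>\<close>-seminorm. Functions with bounded seminorm are totally bounded in the supremum
  norm, so the convergence \<open>L\<^sup>n \<phi> \<rightarrow> \<integral>\<phi> d\<mu>\<close> is uniform over them, and together with the
  Lasota--Yorke inequality it becomes exponential. Correlations are \<open>\<integral>\<psi> (L\<^sup>n \<phi> - \<integral>\<phi> d\<mu>) d\<mu>\<close>.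
\<close>

section \<open>Moduli of continuity\<close>

text \<open>Compatibility pairs preimages of nearby points only, so the seminorm bound is localised
  to distances below \<open>r\<close>. The constant \<open>A\<close> is any upper bound, not the
  exact seminorm.\<close>

definition locally_modulus :: "real \<Rightarrow> (real \<Rightarrow> real) \<Rightarrow> real \<Rightarrow> ('a::metric_space \<Rightarrow> real) \<Rightarrow> bool" where
  "locally_modulus r \<Omega> A \<phi> \<longleftrightarrow> (\<forall>x y. dist x y < r \<longrightarrow> \<bar>\<phi> x - \<phi> y\<bar> \<le> A * \<Omega> (dist x y))"

lemma modulus_nonneg: "modulus_of_continuity \<Omega> \<Longrightarrow> 0 \<le> t \<Longrightarrow> 0 \<le> \<Omega> t"
  unfolding modulus_of_continuity_def by (metis less_eq_real_def)

lemma modulus_mono: "modulus_of_continuity \<Omega> \<Longrightarrow> 0 \<le> s \<Longrightarrow> s \<le> t \<Longrightarrow> \<Omega> s \<le> \<Omega> t"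
  unfolding modulus_of_continuity_def by (auto intro: mono_onD)

lemma modulus_small:
  assumes "modulus_of_continuity \<Omega>" "0 < e"
  obtains d where "0 < d" "\<And>t. 0 \<le> t \<Longrightarrow> t < d \<Longrightarrow> \<Omega> t < e"
proof -
  have cont: "continuous_on {0..} \<Omega>" and zero: "\<Omega> 0 = 0" using assms by (auto simp: modulus_of_continuity_def)
  have "\<exists>d>0. \<forall>t\<in>{0..}. dist t 0 < d \<longrightarrow> dist (\<Omega> t) (\<Omega> 0) < e"
    using cont[unfolded continuous_on_iff, rule_format, of 0 e] assms(2) by simp
  then obtain d where d: "d > 0" "\<forall>t\<in>{0..}. dist t 0 < d \<longrightarrow> dist (\<Omega> t) (\<Omega> 0) < e" by blast
  have "\<Omega> t < e" if "0 \<le> t" "t < d" for t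
    using d(2)[rule_format, of t] that zero by (simp add: dist_real_def)
  with that d(1) show ?thesis by blast
qed

lemma modulus_space_bound:
  fixes \<phi> :: "'a::metric_space \<Rightarrow> real"
  assumes "modulus_of_continuity \<Omega>" "\<phi> \<in> modulus_space \<Omega>"
  obtains A where "0 \<le> A" "\<And>x y. \<bar>\<phi> x - \<phi> y\<bar> \<le> A * \<Omega> (dist x y)"
proof -
  have "modulus_seminorm \<Omega> \<phi> < \<infinity>" using assms(2) by (auto simp: modulus_space_def)
  then obtain a where a: "modulus_seminorm \<Omega> \<phi> < ereal a"
    by (rule ereal_dense2[THEN exE]) auto
  \<comment> \<open>On a one-point space the supremum ranges over the empty set, so \<open>a\<close>
    may be negative.\<close>
  have "\<bar>\<phi> x - \<phi> y\<bar> \<le> max 0 a * \<Omega> (dist x y)" for x y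
  proof (cases "x = y")
    case True
    then show ?thesis using modulus_nonneg[OF assms(1)] by simp
  next
    case False
    then have pos: "0 < \<Omega> (dist x y)" using assms(1) by (simp add: modulus_of_continuity_def)
    have "ereal (\<bar>\<phi> x - \<phi> y\<bar> / \<Omega> (dist x y)) \<le> modulus_seminorm \<Omega> \<phi>"
      unfolding modulus_seminorm_def
      by (rule SUP_upper2[where i = "(x, y)"]) (use False in auto)
    also note a
    finally have "\<bar>\<phi> x - \<phi> y\<bar> \<le> a * \<Omega> (dist x y)" using pos by (simp add: divide_simps)
    also have "\<dots> \<le> max 0 a * \<Omega> (dist x y)" using pos by simp
    finally show ?thesis .
  qed
  then show ?thesis using that[of "max 0 a"] by simp
qed

lemma locally_modulus_mono:
  assumes "modulus_of_continuity \<Omega>" "locally_modulus r \<Omega> A \<phi>" "A \<le> A'"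
  shows "locally_modulus r \<Omega> A' \<phi>"
  unfolding locally_modulus_def
proof (intro allI impI)
  fix x y :: 'a assume "dist x y < r"
  then have "\<bar>\<phi> x - \<phi> y\<bar> \<le> A * \<Omega> (dist x y)" using assms(2) by (simp add: locally_modulus_def)
  also have "\<dots> \<le> A' * \<Omega> (dist x y)"
    using assms(3) modulus_nonneg[OF assms(1)] by (intro mult_right_mono) auto
  finally show "\<bar>\<phi> x - \<phi> y\<bar> \<le> A' * \<Omega> (dist x y)" .
qed

lemma locally_modulus_continuous:
  assumes "modulus_of_continuity \<Omega>" "0 < r" "0 \<le> A" "locally_modulus r \<Omega> A \<phi>"
  shows "continuous_on UNIV \<phi>"
  unfolding continuous_on_iff
proof (intro ballI allI impI)
  fix x :: 'a and e :: real assume "0 < e"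
  then obtain d where d: "0 < d" "\<And>t. 0 \<le> t \<Longrightarrow> t < d \<Longrightarrow> \<Omega> t < e / (A + 1)"
    using modulus_small[OF assms(1), of "e / (A + 1)"] assms(3) by auto
  have "dist (\<phi> y) (\<phi> x) < e" if "dist y x < min d r" for y
  proof -
    have "\<bar>\<phi> y - \<phi> x\<bar> \<le> A * \<Omega> (dist y x)" using assms(4) that by (auto simp: locally_modulus_def)
    also have "\<dots> \<le> A * (e / (A + 1))" using d(2)[of "dist y x"] that assms(3)
      by (intro mult_left_mono) auto
    also have "\<dots> < e" using \<open>0 < e\<close> assms(3) by (simp add: field_simps)
    finally show ?thesis by (simp add: dist_real_def)
  qed
  with d(1) assms(2) show "\<exists>d>0. \<forall>y\<in>UNIV. dist y x < d \<longrightarrow> dist (\<phi> y) (\<phi> x) < e"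
    by (intro exI[of _ "min d r"]) auto
qed

text \<open>Orderly vanishing gives \<open>2 * \<Omega> d \<le> \<Omega> (d / x)\<close> for a fixed \<open>x\<close>, and \<open>d\<close> is a convex
  combination of \<open>l * d\<close> and \<open>d / x\<close>.\<close>

lemma orderly_contraction:
  assumes mod: "modulus_of_continuity \<Omega>" and conc: "concave_on {0..} \<Omega>"
    and ord: "vanishes_orderly \<Omega>" and l: "0 \<le> l" "l < 1"
  obtains c r where "0 < c" "0 < r" "\<And>d s. 0 < d \<Longrightarrow> d < r \<Longrightarrow> 0 \<le> s \<Longrightarrow> s \<le> l * d \<Longrightarrow> \<Omega> s \<le> (1 - c) * \<Omega> d"
proof -
  have "eventually (\<lambda>x. (SUP d\<in>{0<..<1/2}. ereal (\<Omega> (d * x) / \<Omega> d)) < ereal (1/2)) (at_right 0)"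
    using ord unfolding vanishes_orderly_def by (rule order_tendstoD(2)) simp
  moreover have "eventually (\<lambda>x::real. x \<in> {0<..<1}) (at_right 0)"
    by (rule eventually_at_right_real) simp
  ultimately have "eventually (\<lambda>x. (SUP d\<in>{0<..<1/2}. ereal (\<Omega> (d * x) / \<Omega> d)) < ereal (1/2) \<and> x \<in> {0<..<1}) (at_right 0)"
    by (rule eventually_conj)
  from eventually_happens'[OF trivial_limit_at_right_real this] obtain x where
      sup: "(SUP d\<in>{0<..<1/2}. ereal (\<Omega> (d * x) / \<Omega> d)) < ereal (1/2)" and "x \<in> {0<..<1}"
    by (elim exE conjE)
  then have x: "0 < x" "x < 1" by simp_all
  have half: "2 * \<Omega> (d * x) \<le> \<Omega> d" if "0 < d" "d < 1/2" for d
  proof -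
    have "ereal (\<Omega> (d * x) / \<Omega> d) < ereal (1/2)"
      by (rule le_less_trans[OF SUP_upper sup]) (use that in auto)
    moreover have "0 < \<Omega> d" using mod that by (simp add: modulus_of_continuity_def)
    ultimately show ?thesis by (simp add: divide_simps)
  qed
  have "1 / x > 1" using x by simp
  then have den: "0 < 1 / x - l" using l by simp
  \<comment> \<open>The weight for which \<open>(1 - u) * (l * d) + u * (d / x)\<close> equals
    \<open>d\<close>.\<close>
  define u where "u = (1 - l) / (1 / x - l)"
  have u: "0 < u" "u < 1" using l den \<open>1 / x > 1\<close> by (auto simp: u_def simp del: less_divide_eq_1)
  \<comment> \<open>\<open>d < x / 2\<close> puts \<open>d / x\<close> below \<open>1 / 2\<close>,
    where \<open>half\<close> applies. The gain comes from
    \<open>(1 - 2 * u) / (1 - u) = 1 - u / (1 - u)\<close>.\<close>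
  have main: "\<Omega> s \<le> (1 - u / (1 - u)) * \<Omega> d" if d: "0 < d" "d < x / 2" "0 \<le> s" "s \<le> l * d" for d s
  proof -
    have "u * (1 / x - l) = 1 - l" using den by (simp add: u_def)
    then have "(1 - u) * l + u / x = 1" by (simp add: algebra_simps)
    then have "((1 - u) * l + u / x) * d = d" by simp
    then have comb: "(1 - u) * (l * d) + u * (d / x) = d" by (simp add: distrib_right mult.assoc)
    have "(1 - u) * \<Omega> (l * d) + u * \<Omega> (d / x) \<le> \<Omega> d"
      using concave_onD[OF conc, of u "l * d" "d / x"] u x l d comb
      by simp
    moreover have "2 * \<Omega> d \<le> \<Omega> (d / x)" using half[of "d / x"] x d by (simp add: field_simps)
    then have "u * (2 * \<Omega> d) \<le> u * \<Omega> (d / x)" using u by simp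
    ultimately have "(1 - u) * \<Omega> (l * d) \<le> (1 - 2 * u) * \<Omega> d" by (simp add: algebra_simps)
    then have "\<Omega> (l * d) \<le> (1 - 2 * u) * \<Omega> d / (1 - u)" using u by (simp add: field_simps)
    also have "\<dots> = (1 - u / (1 - u)) * \<Omega> d" using u by (simp add: field_simps)
    finally show ?thesis using modulus_mono[OF mod, of s "l * d"] d by simp
  qed
  show ?thesis using that[of "u / (1 - u)" "x / 2"] main u x by auto
qed

section \<open>Total boundedness in the supremum norm\<close>

text \<open>One half of Arzela-Ascoli: on a finite \<open>d\<close>-net, values rounded to multiples
  of \<open>e\<close> leave finitely many patterns, and functions with the same pattern are close.
  The representatives are taken inside \<open>F\<close> so that they keep the properties of
  \<open>F\<close>.\<close>

lemma finite_net_equicontinuous: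
  fixes F :: "('a::metric_space \<Rightarrow> real) set"
  assumes cpt: "compact (UNIV :: 'a set)" and e: "0 < e"
    and bdd: "\<And>\<phi> x. \<phi> \<in> F \<Longrightarrow> \<bar>\<phi> x\<bar> \<le> S"
    and d: "0 < d" "\<And>\<phi> x y. \<phi> \<in> F \<Longrightarrow> dist x y < d \<Longrightarrow> \<bar>\<phi> x - \<phi> y\<bar> \<le> e"
  obtains F0 where "finite F0" "F0 \<subseteq> F" "\<And>\<phi>. \<phi> \<in> F \<Longrightarrow> \<exists>\<psi>\<in>F0. \<forall>x. \<bar>\<phi> x - \<psi> x\<bar> \<le> 3 * e"
proof -
  obtain X :: "'a set" where X: "finite X" "UNIV \<subseteq> (\<Union>p\<in>X. ball p d)"
  proof (rule compactE_image[OF cpt, of UNIV "\<lambda>p. ball p d"])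
    show "UNIV \<subseteq> (\<Union>p::'a. ball p d)"
    proof
      fix x :: 'a
      have "x \<in> ball x d" using d(1) by simp
      then show "x \<in> (\<Union>p. ball p d)" by blast
    qed
  qed (simp_all add: that)
  define c where "c = (\<lambda>\<phi>::'a \<Rightarrow> real. restrict (\<lambda>p. \<lfloor>\<phi> p / e\<rfloor>) X)"
  have "c ` F \<subseteq> (\<Pi>\<^sub>E p\<in>X. {\<lfloor>- S / e\<rfloor>..\<lfloor>S / e\<rfloor>})"
  proof (intro image_subsetI PiE_I)
    fix \<phi> p assume "\<phi> \<in> F" "p \<in> X"
    then have "\<bar>\<phi> p\<bar> \<le> S" using bdd by auto
    then have "- S \<le> \<phi> p" "\<phi> p \<le> S" by auto
    then have "- S / e \<le> \<phi> p / e" "\<phi> p / e \<le> S / e" using e divide_right_mono[of "- S" "\<phi> p" e] by (simp_all add: divide_right_mono del: minus_divide_left)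
    then show "c \<phi> p \<in> {\<lfloor>- S / e\<rfloor>..\<lfloor>S / e\<rfloor>}" using \<open>p \<in> X\<close> by (auto simp: c_def intro: floor_mono)
  qed (simp add: c_def)
  then have fin: "finite (c ` F)"
    by (rule finite_subset) (use X in \<open>auto intro: finite_PiE\<close>)
  show ?thesis
  proof (rule that[of "inv_into F c ` c ` F"])
    show "finite (inv_into F c ` c ` F)" using fin by simp
    show "inv_into F c ` c ` F \<subseteq> F" by (metis image_subsetI inv_into_into)
    fix \<phi> assume "\<phi> \<in> F"
    define \<psi> where "\<psi> = inv_into F c (c \<phi>)"
    have \<psi>: "\<psi> \<in> F" "c \<psi> = c \<phi>" using \<open>\<phi> \<in> F\<close> by (auto simp: \<psi>_def inv_into_into f_inv_into_f)
    \<comment> \<open>One \<open>e\<close> from the common rounding at the net point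
      \<open>p\<close>, and one from each oscillation between \<open>p\<close> and
      \<open>x\<close>.\<close>
    have "\<bar>\<phi> x - \<psi> x\<bar> \<le> 3 * e" for x
    proof -
      have "x \<in> (\<Union>p\<in>X. ball p d)" using X(2) by blast
      then obtain p where p: "p \<in> X" "dist p x < d" by auto
      have "\<lfloor>\<phi> p / e\<rfloor> = \<lfloor>\<psi> p / e\<rfloor>" using \<psi>(2) p(1) unfolding c_def by (metis restrict_apply')
      then have "\<bar>\<phi> p / e - \<psi> p / e\<bar> \<le> 1" by linarith
      then have "\<bar>\<phi> p - \<psi> p\<bar> \<le> e" using e by (simp add: abs_le_iff field_simps)
      then show ?thesis using d(2)[OF \<open>\<phi> \<in> F\<close> p(2)] d(2)[OF \<psi>(1) p(2)] by linarith
    qed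
    then show "\<exists>\<psi>\<in>inv_into F c ` c ` F. \<forall>x. \<bar>\<phi> x - \<psi> x\<bar> \<le> 3 * e"
      using \<open>\<phi> \<in> F\<close> \<psi>_def by blast
  qed
qed


section \<open>Exponential decay from a Lasota--Yorke inequality\<close>

text \<open>The properties of the normalised operator from which decay follows. Supremum norms enter
  as arbitrary pointwise bounds \<open>S\<close>.\<close>

locale markov_lasota_yorke =
  fixes L :: "('a::metric_space \<Rightarrow> real) \<Rightarrow> 'a \<Rightarrow> real" and \<Omega> r \<theta> B
  assumes compact_space: "compact (UNIV :: 'a set)"
    and modulus: "modulus_of_continuity \<Omega>"
    and r_pos: "0 < r"
    and \<theta>: "0 \<le> \<theta>" "\<theta> < 1"
    and B: "0 \<le> B"
    and diff: "L (\<lambda>x. \<phi> x - \<psi> x) = (\<lambda>x. L \<phi> x - L \<psi> x)"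
    and scale: "L (\<lambda>x. a * \<phi> x) = (\<lambda>x. a * L \<phi> x)"
    and bound: "(\<And>x. \<bar>\<phi> x\<bar> \<le> S) \<Longrightarrow> \<bar>L \<phi> x\<bar> \<le> S"
    and lasota_yorke: "0 \<le> A \<Longrightarrow> locally_modulus r \<Omega> A \<phi> \<Longrightarrow> (\<And>x. \<bar>\<phi> x\<bar> \<le> S) \<Longrightarrow>
      locally_modulus r \<Omega> (\<theta> * A + B * S) (L \<phi>)"
begin

lemma diff_pow: "(L ^^ n) (\<lambda>x. \<phi> x - \<psi> x) = (\<lambda>x. (L ^^ n) \<phi> x - (L ^^ n) \<psi> x)"
  by (induction n) (auto simp: diff)

lemma scale_pow: "(L ^^ n) (\<lambda>x. a * \<phi> x) = (\<lambda>x. a * (L ^^ n) \<phi> x)"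
  by (induction n) (auto simp: scale)

lemma bound_pow: "(\<And>x. \<bar>\<phi> x\<bar> \<le> S) \<Longrightarrow> \<bar>(L ^^ n) \<phi> x\<bar> \<le> S"
  by (induction n arbitrary: x) (auto intro: bound)

text \<open>\<open>B / (1 - \<theta>)\<close> sums the geometric series of errors of the iterated
  inequality; the added \<open>1\<close> makes \<open>M\<close> positive even for
  \<open>B = 0\<close>.\<close>

definition M where "M = B / (1 - \<theta>) + 1"

lemma M_absorbing: "0 < M" "\<theta> * M + B \<le> M"
proof -
  show "0 < M" using \<theta> B by (simp add: M_def add_nonneg_pos)
  have "(1 - \<theta>) * M = B + (1 - \<theta>)" using \<theta> by (simp add: M_def distrib_left)
  then have "B \<le> (1 - \<theta>) * M" using \<theta> by simp
  then show "\<theta> * M + B \<le> M" by (simp add: algebra_simps)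
qed

text \<open>The bound \<open>S\<close> survives every step, and
  \<open>\<theta> * M + B \<le> M\<close> absorbs each new error \<open>B * S\<close> into
  \<open>M * S\<close>.\<close>

lemma lasota_yorke_pow:
  assumes A: "0 \<le> A" "locally_modulus r \<Omega> A \<phi>" "\<And>x. \<bar>\<phi> x\<bar> \<le> S"
  shows "locally_modulus r \<Omega> (\<theta> ^ n * A + M * S) ((L ^^ n) \<phi>)"
proof -
  have S: "0 \<le> S" using A(3)[of undefined] by linarith
  note mono = locally_modulus_mono[OF modulus]
  show ?thesis
  proof (induction n)
    case 0
    show ?case using mono[OF A(2), of "A + M * S"] M_absorbing S by simp
  next
    case (Suc n)
    have "locally_modulus r \<Omega> (\<theta> * (\<theta> ^ n * A + M * S) + B * S) (L ((L ^^ n) \<phi>))"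
      by (rule lasota_yorke) (use Suc A S M_absorbing \<theta> bound_pow in auto)
    moreover have "\<theta> * (\<theta> ^ n * A + M * S) + B * S \<le> \<theta> ^ Suc n * A + M * S"
      using mult_right_mono[OF M_absorbing(2) S] by (simp add: algebra_simps)
    ultimately show ?case using mono by simp
  qed
qed

text \<open>The constant \<open>2 * M\<close> leaves room for the modulus constant to halve as well as the
  supremum: the Lasota--Yorke inequality brings it back near \<open>M\<close>.\<close>

definition decaying :: "real \<Rightarrow> ('a \<Rightarrow> real) set" where
  "decaying S = {\<phi>. (\<forall>x. \<bar>\<phi> x\<bar> \<le> S) \<and> locally_modulus r \<Omega> (2 * M * S) \<phi> \<and>
     uniform_limit UNIV (\<lambda>n. (L ^^ n) \<phi>) (\<lambda>_. 0) sequentially}"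

text \<open>Homogeneity, which reduces the halving below to \<open>S = 1\<close>.\<close>

lemma decaying_scale:
  assumes "\<phi> \<in> decaying S" "0 < a"
  shows "(\<lambda>x. a * \<phi> x) \<in> decaying (a * S)"
proof -
  have "uniform_limit UNIV (\<lambda>n x. a * (L ^^ n) \<phi> x) (\<lambda>_. a * 0) sequentially"
    using assms(1) unfolding decaying_def
    by (intro bounded_linear.uniform_limit[OF bounded_linear_mult_right]) auto
  moreover have "\<bar>a * \<phi> x\<bar> \<le> a * S" for x
    using assms by (auto simp: decaying_def abs_mult)
  moreover have "locally_modulus r \<Omega> (2 * M * (a * S)) (\<lambda>x. a * \<phi> x)"
    unfolding locally_modulus_def
  proof (intro allI impI)
    fix x y :: 'a assume "dist x y < r"
    then have "\<bar>\<phi> x - \<phi> y\<bar> \<le> 2 * M * S * \<Omega> (dist x y)"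
      using assms(1) by (auto simp: decaying_def locally_modulus_def)
    then have "a * \<bar>\<phi> x - \<phi> y\<bar> \<le> a * (2 * M * S * \<Omega> (dist x y))"
      using assms(2) by simp
    then show "\<bar>a * \<phi> x - a * \<phi> y\<bar> \<le> 2 * M * (a * S) * \<Omega> (dist x y)"
      using assms(2) by (simp add: abs_mult mult_ac flip: right_diff_distrib)
  qed
  ultimately show ?thesis by (simp add: decaying_def scale_pow)
qed

text \<open>Each function in \<open>decaying 1\<close> tends to zero at a rate of its own. A finite
  net makes the time uniform, since contraction of the supremum norm keeps every function within
  \<open>1 / 8\<close> of its neighbour in the net.\<close>

lemma decaying_uniform: "\<exists>n. \<forall>\<phi>\<in>decaying 1. \<forall>x. \<bar>(L ^^ n) \<phi> x\<bar> \<le> 1 / 4"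
proof -
  \<comment> \<open>\<open>2 * M\<close> is the modulus constant for \<open>S = 1\<close>;
    oscillation \<open>1 / 24\<close> yields a net of mesh \<open>3 / 24 = 1 / 8\<close>.\<close>
  obtain d where d: "0 < d" "\<And>t. 0 \<le> t \<Longrightarrow> t < d \<Longrightarrow> \<Omega> t < 1 / 24 / (2 * M)"
    using modulus_small[OF modulus, of "1 / 24 / (2 * M)"] M_absorbing by auto
  have equi: "\<bar>\<phi> x - \<phi> y\<bar> \<le> 1 / 24" if "\<phi> \<in> decaying 1" "dist x y < min d r" for \<phi> x y
  proof -
    have "\<bar>\<phi> x - \<phi> y\<bar> \<le> 2 * M * \<Omega> (dist x y)"
      using that by (auto simp: decaying_def locally_modulus_def)
    also have "\<dots> \<le> 1 / 24" using d(2)[of "dist x y"] that M_absorbing by (simp add: field_simps)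
    finally show ?thesis .
  qed
  obtain F where F: "finite F" "F \<subseteq> decaying 1"
      "\<And>\<phi>. \<phi> \<in> decaying 1 \<Longrightarrow> \<exists>\<psi>\<in>F. \<forall>x. \<bar>\<phi> x - \<psi> x\<bar> \<le> 3 * (1 / 24)"
    by (rule finite_net_equicontinuous[OF compact_space, of "1 / 24" "decaying 1" 1 "min d r"])
      (use equi d r_pos in \<open>auto simp: decaying_def\<close>)
  have "\<forall>\<psi>\<in>F. eventually (\<lambda>n. \<forall>x. \<bar>(L ^^ n) \<psi> x\<bar> < 1 / 8) sequentially"
  proof
    fix \<psi> assume "\<psi> \<in> F"
    then have "uniform_limit UNIV (\<lambda>n. (L ^^ n) \<psi>) (\<lambda>_. 0) sequentially"
      using F(2) by (auto simp: decaying_def)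
    from uniform_limitD[OF this, of "1 / 8"]
    show "eventually (\<lambda>n. \<forall>x. \<bar>(L ^^ n) \<psi> x\<bar> < 1 / 8) sequentially" by simp
  qed
  then have "eventually (\<lambda>n. \<forall>\<psi>\<in>F. \<forall>x. \<bar>(L ^^ n) \<psi> x\<bar> < 1 / 8) sequentially"
    using F(1) by (rule eventually_ball_finite[rotated])
  then obtain n where n: "\<And>\<psi> x. \<psi> \<in> F \<Longrightarrow> \<bar>(L ^^ n) \<psi> x\<bar> < 1 / 8"
    using eventually_happens'[OF sequentially_bot] by blast
  have "\<bar>(L ^^ n) \<phi> x\<bar> \<le> 1 / 4" if \<phi>: "\<phi> \<in> decaying 1" for \<phi> x
  proof -
    obtain \<psi> where \<psi>: "\<psi> \<in> F" "\<And>x. \<bar>\<phi> x - \<psi> x\<bar> \<le> 1 / 8" using F(3)[OF \<phi>] by auto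
    have "\<bar>(L ^^ n) \<phi> x - (L ^^ n) \<psi> x\<bar> \<le> 1 / 8"
      using bound_pow[of "\<lambda>x. \<phi> x - \<psi> x" "1 / 8" n x] \<psi>(2) by (simp add: diff_pow)
    then show ?thesis using n[OF \<psi>(1), of x] by linarith
  qed
  then show ?thesis by blast
qed

text \<open>The first \<open>n\<close> steps shrink the supremum to \<open>1 / 4\<close>;
  \<open>k\<close> more bring the modulus constant down to \<open>M\<close>, the value required in
  \<open>decaying (1 / 2)\<close>.\<close>

lemma decaying_halves:
  obtains p where "0 < p" "\<And>S \<phi>. 0 < S \<Longrightarrow> \<phi> \<in> decaying S \<Longrightarrow> (L ^^ p) \<phi> \<in> decaying (S / 2)"
proof -
  obtain n where n: "\<And>\<phi> x. \<phi> \<in> decaying 1 \<Longrightarrow> \<bar>(L ^^ n) \<phi> x\<bar> \<le> 1 / 4"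
    using decaying_uniform by blast
  have "(\<lambda>k. \<theta> ^ k) \<longlonglongrightarrow> 0" using \<theta> by (intro LIMSEQ_realpow_zero) auto
  \<comment> \<open>\<open>k > 0\<close> makes the period \<open>k + n\<close> positive, so that a
    root of that order can be taken later.\<close>
  then have "eventually (\<lambda>k. \<theta> ^ k < 1 / 4 \<and> k > 0) sequentially"
    by (intro eventually_conj order_tendstoD eventually_gt_at_top) auto
  then obtain k where k: "\<theta> ^ k < 1 / 4" "0 < k"
    using eventually_happens'[OF sequentially_bot] by blast
  have unit: "(L ^^ (k + n)) \<phi> \<in> decaying (1 / 2)" if \<phi>: "\<phi> \<in> decaying 1" for \<phi>
  proof -
    have "locally_modulus r \<Omega> (\<theta> ^ n * (2 * M) + M * 1) ((L ^^ n) \<phi>)"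
      by (rule lasota_yorke_pow) (use \<phi> M_absorbing in \<open>auto simp: decaying_def\<close>)
    \<comment> \<open>Restarting the inequality after \<open>n\<close> steps profits from the
      smaller supremum: the error is only \<open>M / 4\<close>, and the other term is at most
      \<open>3 * M / 4\<close>.\<close>
    then have "locally_modulus r \<Omega> (\<theta> ^ k * (\<theta> ^ n * (2 * M) + M) + M * (1 / 4)) ((L ^^ k) ((L ^^ n) \<phi>))"
      by (intro lasota_yorke_pow n \<phi>) (use M_absorbing \<theta> in auto)
    moreover have "\<theta> ^ k * (\<theta> ^ n * (2 * M) + M) + M * (1 / 4) \<le> M"
    proof -
      have "\<theta> ^ n \<le> 1" using \<theta> by (simp add: power_le_one)
      then have "\<theta> ^ n * (2 * M) + M \<le> 3 * M" using M_absorbing by simp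
      then have "\<theta> ^ k * (\<theta> ^ n * (2 * M) + M) \<le> 1 / 4 * (3 * M)"
        using k M_absorbing \<theta> by (intro mult_mono) auto
      then show ?thesis by simp
    qed
    ultimately have "locally_modulus r \<Omega> M ((L ^^ (k + n)) \<phi>)"
      by (simp add: funpow_add locally_modulus_mono[OF modulus])
    moreover have "\<bar>(L ^^ (k + n)) \<phi> x\<bar> \<le> 1 / 2" for x
      using bound_pow[of "(L ^^ n) \<phi>" "1 / 4" k x] n[OF \<phi>] by (simp add: funpow_add)
    moreover have "uniform_limit UNIV (\<lambda>i. (L ^^ i) ((L ^^ (k + n)) \<phi>)) (\<lambda>_. 0) sequentially"
    proof -
      have "uniform_limit UNIV (\<lambda>i. (L ^^ (i + (k + n))) \<phi>) (\<lambda>_. 0) sequentially"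
        using \<phi> unfolding decaying_def
        by (intro filterlim_compose[OF _ filterlim_add_const_nat_at_top, where g = "\<lambda>i. (L ^^ i) \<phi>"]) auto
      then show ?thesis unfolding funpow_add o_def .
    qed
    ultimately show ?thesis by (simp add: decaying_def)
  qed
  have "(L ^^ (k + n)) \<phi> \<in> decaying (S / 2)" if S: "0 < S" and \<phi>: "\<phi> \<in> decaying S" for S \<phi>
  proof -
    have "(\<lambda>x. inverse S * \<phi> x) \<in> decaying 1" using decaying_scale[OF \<phi>, of "inverse S"] S by simp
    from decaying_scale[OF unit[OF this] S] show ?thesis using S
      by (simp add: scale_pow flip: mult.assoc)
  qed
  then show ?thesis using that[of "k + n"] k by auto
qed

theorem exponential_decay:
  obtains \<rho> where "0 < \<rho>" "\<rho> < 1"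
    "\<And>A \<phi>. 0 \<le> A \<Longrightarrow> locally_modulus r \<Omega> A \<phi> \<Longrightarrow>
       uniform_limit UNIV (\<lambda>n. (L ^^ n) \<phi>) (\<lambda>_. 0) sequentially \<Longrightarrow>
       \<exists>K>0. \<forall>n x. \<bar>(L ^^ n) \<phi> x\<bar> \<le> K * \<rho> ^ n"
proof -
  obtain p where p: "0 < p" "\<And>S \<phi>. 0 < S \<Longrightarrow> \<phi> \<in> decaying S \<Longrightarrow> (L ^^ p) \<phi> \<in> decaying (S / 2)"
    using decaying_halves by blast
  \<comment> \<open>Halving once every \<open>p\<close> steps is decay at the rate
    \<open>\<rho>\<close> with \<open>\<rho> ^ p = 1 / 2\<close>.\<close>
  define \<rho> where "\<rho> = root p (1 / 2)"
  have \<rho>: "0 < \<rho>" "\<rho> < 1" "\<rho> ^ p = 1 / 2" using p(1) by (auto simp: \<rho>_def)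
  have "\<exists>K>0. \<forall>n x. \<bar>(L ^^ n) \<phi> x\<bar> \<le> K * \<rho> ^ n"
    if A: "0 \<le> A" "locally_modulus r \<Omega> A \<phi>"
      and lim: "uniform_limit UNIV (\<lambda>n. (L ^^ n) \<phi>) (\<lambda>_. 0) sequentially" for A \<phi>
  proof -
    have "bounded (range \<phi>)"
      using compact_continuous_image[OF locally_modulus_continuous[OF modulus r_pos A] compact_space]
      by (rule compact_imp_bounded)
    then obtain b where b: "\<And>x. \<bar>\<phi> x\<bar> \<le> b" by (auto simp: bounded_iff)
    \<comment> \<open>Large enough for both bounds in \<open>decaying S\<close>; the extra
      \<open>1\<close> keeps \<open>S\<close> positive.\<close>
    define S where "S = max b (A / (2 * M)) + 1"
    have "A / (2 * M) \<le> S" by (simp add: S_def)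
    then have AS: "A \<le> 2 * M * S" using M_absorbing by (simp add: field_simps)
    have "0 \<le> A / (2 * M)" using A(1) M_absorbing by simp
    then have S: "0 < S" unfolding S_def by linarith
    have base: "\<phi> \<in> decaying S"
      unfolding decaying_def
    proof (intro CollectI conjI allI lim)
      show "\<bar>\<phi> x\<bar> \<le> S" for x using b[of x] by (auto simp: S_def)
      show "locally_modulus r \<Omega> (2 * M * S) \<phi>"
        by (rule locally_modulus_mono[OF modulus A(2) AS])
    qed
    have iter: "(L ^^ (p * k)) \<phi> \<in> decaying (S / 2 ^ k)" for k
    proof (induction k)
      case (Suc k)
      have "(L ^^ p) ((L ^^ (p * k)) \<phi>) \<in> decaying (S / 2 ^ k / 2)"
        by (rule p(2)) (use Suc S in auto)
      then show ?case by (simp add: funpow_add mult.commute)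
    qed (use base in simp)
    have "\<bar>(L ^^ n) \<phi> x\<bar> \<le> 2 * S * \<rho> ^ n" for n x
    proof -
      \<comment> \<open>The \<open>n mod p\<close> steps beyond the full periods do not increase the
        supremum; they cost a factor \<open>2\<close>, since
        \<open>\<rho> ^ (n mod p) \<ge> 1 / 2\<close>.\<close>
      have "(L ^^ n) \<phi> = (L ^^ (n mod p)) ((L ^^ (p * (n div p))) \<phi>)"
        using funpow_add[of "n mod p" "p * (n div p)" L] by simp
      then have "\<bar>(L ^^ n) \<phi> x\<bar> \<le> S / 2 ^ (n div p)"
        using bound_pow[of "(L ^^ (p * (n div p))) \<phi>" "S / 2 ^ (n div p)" "n mod p" x] iter[of "n div p"]
        by (simp add: decaying_def)
      also have "\<dots> = S * \<rho> ^ (p * (n div p))" by (simp add: power_mult \<rho> power_one_over)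
      also have "\<dots> \<le> S * (2 * \<rho> ^ n)"
      proof -
        have "\<rho> ^ p \<le> \<rho> ^ (n mod p)" using \<rho> p(1) by (intro power_decreasing) auto
        then have "1 \<le> 2 * \<rho> ^ (n mod p)" using \<rho>(3) by simp
        then have "\<rho> ^ (p * (n div p)) * 1 \<le> \<rho> ^ (p * (n div p)) * (2 * \<rho> ^ (n mod p))"
          using \<rho> by (intro mult_left_mono) auto
        also have "\<dots> = 2 * \<rho> ^ n" by (simp flip: power_add)
        finally show ?thesis using S by simp
      qed
      finally show ?thesis by simp
    qed
    then show ?thesis using S by (intro exI[of _ "2 * S"]) auto
  qed
  then show ?thesis using that \<rho> by blast
qed

end


section \<open>Expanding circle maps\<close>

text \<open>The covering projection of the line onto the circle, with \<open>coord\<close> as a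
  section.\<close>

definition circle_of :: "real \<Rightarrow> circle" where
  "circle_of r = Abs_circle (frac r)"

lemma coord_bounds: "0 \<le> coord x" "coord x < 1"
  using coord[of x] by auto

lemma coord_circle_of: "coord (circle_of r) = frac r"
  unfolding circle_of_def by (rule Abs_circle_inverse) (simp add: frac_lt_1)

lemma circle_of_coord [simp]: "circle_of (coord x) = x"
proof -
  have "frac (coord x) = coord x" using coord_bounds[of x] by (simp add: frac_eq)
  then show ?thesis by (simp add: circle_of_def coord_inverse)
qed

lemma circle_of_add_of_int: "circle_of (r + of_int k) = circle_of r"
  by (simp add: circle_of_def frac_def)

lemma circle_map_eq: "circle_map V x = circle_of (coord x * (1 + V (coord x)))"
  by (simp add: circle_map_def circle_of_def)

text \<open>Coordinates differ by less than one, so the three-term minimum is the distance from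
  \<open>r - s\<close> to the nearest integer.\<close>

lemma dist_circle_of:
  shows "dist (circle_of r) (circle_of s) \<le> \<bar>r - s\<bar>"
    and "\<bar>r - s\<bar> \<le> 1 / 2 \<Longrightarrow> dist (circle_of r) (circle_of s) = \<bar>r - s\<bar>"
proof -
  define a where "a = frac r - frac s"
  define k where "k = \<lfloor>r\<rfloor> - \<lfloor>s\<rfloor>"
  have a: "\<bar>a\<bar> < 1"
    using frac_ge_0[of r] frac_ge_0[of s] frac_lt_1[of r] frac_lt_1[of s] unfolding a_def by linarith
  have rs: "r - s = a + of_int k" by (simp add: a_def k_def frac_def)
  have d: "dist (circle_of r) (circle_of s) = min \<bar>a\<bar> (min \<bar>a + 1\<bar> \<bar>a - 1\<bar>)"
    by (simp add: dist_circle_def coord_circle_of a_def)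
  have k: "k = 0 \<or> k = 1 \<or> k = -1 \<or> real_of_int k \<ge> 2 \<or> real_of_int k \<le> -2" by linarith
  show "dist (circle_of r) (circle_of s) \<le> \<bar>r - s\<bar>"
    using k a unfolding d rs by auto
  show "dist (circle_of r) (circle_of s) = \<bar>r - s\<bar>" if "\<bar>r - s\<bar> \<le> 1 / 2"
    using k a that unfolding d rs by (auto simp: min_def)
qed

text \<open>If the shortest arc crosses \<open>0\<close>, the endpoint with the larger coordinate is
  moved back by one turn.\<close>

lemma circle_lifts:
  obtains s t where "s \<in> {-1..1}" "t \<in> {-1..1}" "x = circle_of s" "y = circle_of t" "\<bar>s - t\<bar> = dist x y"
proof -
  have sub: "circle_of (coord w - 1) = w" for w
    using circle_of_add_of_int[of "coord w" "-1"] by simp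
  have "dist x y = \<bar>coord x - coord y\<bar> \<or> dist x y = \<bar>coord x - (coord y - 1)\<bar>
    \<or> dist x y = \<bar>(coord x - 1) - coord y\<bar>"
    by (auto simp: dist_circle_def min_def algebra_simps)
  moreover have "coord w \<in> {-1..1}" "coord w - 1 \<in> {-1..1}" for w
    using coord_bounds[of w] by auto
  ultimately show ?thesis using that sub circle_of_coord by metis
qed

lemma compact_circle: "compact (UNIV :: circle set)"
proof -
  have "continuous_on {0..1} circle_of"
    unfolding continuous_on_iff
  proof (intro ballI allI impI)
    fix x e :: real assume "e > 0"
    then show "\<exists>d>0. \<forall>x'\<in>{0..1}. dist x' x < d \<longrightarrow> dist (circle_of x') (circle_of x) < e"
      using dist_circle_of(1) by (intro exI[of _ e]) (auto simp: dist_real_def intro: le_less_trans)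
  qed
  then have "compact (circle_of ` {0..1})" by (rule compact_continuous_image) simp
  moreover have "x \<in> circle_of ` {0..1}" for x
    by (rule image_eqI[of _ _ "coord x"]) (use coord_bounds[of x] in auto)
  then have "circle_of ` {0..1} = UNIV" by blast
  ultimately show ?thesis by simp
qed

text \<open>A lift of the circle map to \<open>[-1, 1]\<close>, so that arcs across the fixed point \<open>0\<close> are covered;
  the degree of the map is \<open>1 + V 1\<close>.\<close>

definition circle_lift :: "(real \<Rightarrow> real) \<Rightarrow> real \<Rightarrow> real" where
  "circle_lift V s = (if 0 \<le> s then s * (1 + V s) else (s + 1) * (1 + V (s + 1)) - (1 + V 1))"

locale expanding_circle_map =
  fixes V :: "real \<Rightarrow> real"
  assumes admissible: "admissible V"
begin

abbreviation T :: "circle \<Rightarrow> circle" where "T \<equiv> circle_map V"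

lemma V_nonneg: "0 \<le> s \<Longrightarrow> 0 \<le> V s"
  and V_less: "0 \<le> s \<Longrightarrow> s < t \<Longrightarrow> V s < V t"
  and V_continuous: "continuous_on {0..} V"
  using admissible unfolding admissible_def by (auto intro: strict_mono_onD)

lemma V_one: obtains N :: nat where "0 < N" "V 1 = real N"
  using admissible unfolding admissible_def by auto

text \<open>The right side exceeds the left by \<open>t * (V t - V s)\<close>, which is nonnegative.
  Away from \<open>0\<close> the factor \<open>1 + V s\<close> stays above a constant larger than
  one.\<close>

lemma profile_expanding:
  assumes "0 \<le> s" "s \<le> t"
  shows "(1 + V s) * (t - s) \<le> t * (1 + V t) - s * (1 + V s)"
proof -
  have "V s \<le> V t" using V_less[of s t] assms by (cases "s = t") auto
  then have "0 \<le> t * (V t - V s)" using assms by simp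
  then show ?thesis by (simp add: algebra_simps)
qed

lemma profile_expanding_1:
  assumes "0 \<le> s" "s \<le> t"
  shows "t - s \<le> t * (1 + V t) - s * (1 + V s)"
proof -
  have "0 \<le> V s * (t - s)" using assms V_nonneg by simp
  then show ?thesis using profile_expanding[OF assms] by (simp add: algebra_simps)
qed

lemma circle_lift_semiconj:
  assumes "s \<in> {-1..1}"
  shows "T (circle_of s) = circle_of (circle_lift V s)"
proof -
  obtain N :: nat where N: "V 1 = real N" using V_one by blast
  consider "0 \<le> s" "s < 1" | "s = 1" | "-1 \<le> s" "s < 0" using assms by fastforce
  then show ?thesis
  proof cases
    case 1
    then have "frac s = s" by (simp add: frac_eq)
    with 1 show ?thesis by (simp add: circle_map_eq coord_circle_of circle_lift_def)
  next
    case 2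
    \<comment> \<open>The point \<open>1\<close> projects to the fixed point \<open>0\<close>; its
      lifted image \<open>1 + N\<close> projects there too because it is an integer.\<close>
    have "circle_of (0 + of_int (1 + int N)) = circle_of 0" by (rule circle_of_add_of_int)
    then have "circle_of (1 + real N) = circle_of 0" by simp
    with 2 show ?thesis by (simp add: circle_map_eq coord_circle_of circle_lift_def N)
  next
    case 3
    have "circle_of (s + 1 + of_int (-1)) = circle_of (s + 1)" by (rule circle_of_add_of_int)
    then have s: "circle_of s = circle_of (s + 1)" by simp
    have "frac (s + 1) = s + 1" using 3 by (simp add: frac_eq)
    then have "T (circle_of s) = circle_of ((s + 1) * (1 + V (s + 1)))"
      by (simp add: s circle_map_eq coord_circle_of)
    also have "\<dots> = circle_of ((s + 1) * (1 + V (s + 1)) + of_int (- (1 + int N)))"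
      by (rule circle_of_add_of_int[symmetric])
    finally show ?thesis using 3 by (simp add: circle_lift_def N algebra_simps)
  qed
qed

lemma circle_lift_expanding:
  assumes "-1 \<le> s" "s \<le> t" "t \<le> 1"
  shows "t - s \<le> circle_lift V t - circle_lift V s"
proof -
  consider "0 \<le> s" | "t < 0" | "s < 0" "0 \<le> t" by linarith
  then show ?thesis
  proof cases
    case 1
    then show ?thesis using profile_expanding_1[of s t] assms by (simp add: circle_lift_def)
  next
    case 2
    then show ?thesis using profile_expanding_1[of "s + 1" "t + 1"] assms by (simp add: circle_lift_def)
  next
    case 3
    \<comment> \<open>The arc crosses \<open>0\<close> and is split there: the left piece ends at
      shifted coordinate \<open>1\<close>, the right one starts at \<open>0\<close>.\<close>
    then show ?thesis using profile_expanding_1[of "s + 1" 1] profile_expanding_1[of 0 t] assms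
      by (simp add: circle_lift_def)
  qed
qed

lemma profile_continuous: "continuous_on {0..} (\<lambda>s. s * (1 + V s))"
  by (intro continuous_intros V_continuous)

lemma circle_lift_continuous: "continuous_on {-1..1} (circle_lift V)"
proof -
  have sh: "continuous_on {-1..0} (\<lambda>s. (s + 1) * (1 + V (s + 1)) - (1 + V 1))"
    by (intro continuous_intros continuous_on_compose2[OF V_continuous]) auto
  have "continuous_on ({0..1} \<union> {-1..0}) (\<lambda>s. if 0 \<le> s then s * (1 + V s) else (s + 1) * (1 + V (s + 1)) - (1 + V 1))"
    by (rule continuous_on_cases)
      (auto intro!: sh continuous_on_subset[OF profile_continuous])
  moreover have "{0..1} \<union> {-1..0} = {-1..1::real}" by auto
  ultimately show ?thesis unfolding circle_lift_def[abs_def] by simp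
qed

text \<open>Images are compared on the line. The upper bound \<open>e\<close> gives continuity of
  \<open>T\<close>; for \<open>e = 1 / 2\<close> line and circle distances agree, so the lower bound
  shows that \<open>T\<close> does not shrink small distances.\<close>

lemma lifted_images:
  assumes "0 < e"
  obtains d where "0 < d" "\<And>x y. dist x y < d \<Longrightarrow>
    \<exists>s t. T x = circle_of s \<and> T y = circle_of t \<and> dist x y \<le> \<bar>s - t\<bar> \<and> \<bar>s - t\<bar> < e"
proof -
  have "uniformly_continuous_on {-1..1} (circle_lift V)"
    by (rule compact_uniformly_continuous[OF circle_lift_continuous]) simp
  then obtain d where d: "0 < d" "\<And>s t. s \<in> {-1..1} \<Longrightarrow> t \<in> {-1..1} \<Longrightarrow> dist t s < d \<Longrightarrow>
      dist (circle_lift V t) (circle_lift V s) < e"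
    unfolding uniformly_continuous_on_def using assms by blast
  have "\<exists>s t. T x = circle_of s \<and> T y = circle_of t \<and> dist x y \<le> \<bar>s - t\<bar> \<and> \<bar>s - t\<bar> < e"
    if xy: "dist x y < d" for x y
  proof -
    obtain s t where st: "s \<in> {-1..1}" "t \<in> {-1..1}" "x = circle_of s" "y = circle_of t" "\<bar>s - t\<bar> = dist x y"
      by (rule circle_lifts)
    have "\<bar>circle_lift V s - circle_lift V t\<bar> < e"
      using d(2)[of t s] st xy by (simp add: dist_real_def)
    moreover have "dist x y \<le> \<bar>circle_lift V s - circle_lift V t\<bar>"
      using circle_lift_expanding[of s t] circle_lift_expanding[of t s] st by (cases "s \<le> t") auto
    ultimately show ?thesis using st circle_lift_semiconj by blast
  qed
  with that d(1) show ?thesis by blast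
qed

lemma T_continuous: "continuous_on UNIV T"
  unfolding continuous_on_iff
proof (intro ballI allI impI)
  fix x :: circle and e :: real assume "0 < e"
  then obtain d where d: "0 < d" "\<And>x y. dist x y < d \<Longrightarrow>
    \<exists>s t. T x = circle_of s \<and> T y = circle_of t \<and> dist x y \<le> \<bar>s - t\<bar> \<and> \<bar>s - t\<bar> < e"
    using lifted_images by blast
  have "dist (T y) (T x) < e" if "dist y x < d" for y
    using d(2)[OF that] dist_circle_of(1) by (metis le_less_trans)
  with d(1) show "\<exists>d>0. \<forall>y\<in>UNIV. dist y x < d \<longrightarrow> dist (T y) (T x) < e" by blast
qed

lemma T_locally_expanding:
  obtains d where "0 < d" "\<And>x y. dist x y < d \<Longrightarrow> dist x y \<le> dist (T x) (T y)"
proof -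
  obtain d where d: "0 < d" "\<And>x y. dist x y < d \<Longrightarrow>
    \<exists>s t. T x = circle_of s \<and> T y = circle_of t \<and> dist x y \<le> \<bar>s - t\<bar> \<and> \<bar>s - t\<bar> < 1 / 2"
    using lifted_images[of "1 / 2"] by (auto simp del: ex_simps)
  have "dist x y \<le> dist (T x) (T y)" if "dist x y < d" for x y
    using d(2)[OF that] dist_circle_of(2) by (metis less_imp_le)
  with that d(1) show ?thesis by blast
qed

text \<open>Near the fixed point \<open>0\<close> the map may be arbitrarily close to an isometry, but every point
  has a preimage in a fixed arc on which \<open>T\<close> expands uniformly.\<close>

lemma expanding_preimage:
  obtains l d where "0 < l" "l < 1" "0 < d"
    "\<And>x. \<exists>z. T z = x \<and> (\<forall>w. dist z w < d \<longrightarrow> dist z w \<le> l * dist x (T w))"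
proof -
  define G where "G = (\<lambda>s. s * (1 + V s))"
  have Gc: "continuous_on {a..b} G" if "0 \<le> a" for a b
    unfolding G_def by (rule continuous_on_subset[OF profile_continuous]) (use that in auto)
  have Gm: "t - s \<le> G t - G s" if "0 \<le> s" "s \<le> t" for s t
    unfolding G_def using profile_expanding_1[OF that] .
  obtain N :: nat where "0 < N" "V 1 = real N" by (rule V_one)
  then have G0: "G 0 = 0" and G1: "2 \<le> G 1" by (auto simp: G_def)
  \<comment> \<open>Since \<open>G 1 \<ge> 2\<close>, the arc from \<open>r0\<close> to
    \<open>r2\<close>, which \<open>G\<close> maps onto one full turn \<open>{1 / 2..3 / 2}\<close>,
    avoids both \<open>0\<close> and \<open>1\<close>.\<close>
  obtain r0 where r0: "0 \<le> r0" "r0 \<le> 1" "G r0 = 1 / 2"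
    using IVT'[of G 0 "1 / 2" 1] Gc G0 G1 by auto
  obtain r2 where r2: "0 \<le> r2" "r2 \<le> 1" "G r2 = 3 / 2"
    using IVT'[of G 0 "3 / 2" 1] Gc G0 G1 by auto
  have "0 < r0" "r2 < 1" using r0 r2 G0 G1 by (force simp: less_le)+
  have "r0 \<le> r2" using Gm[of r2 r0] r0 r2 by linarith
  have pre: "\<exists>z. T z = x \<and> r0 \<le> coord z \<and> coord z \<le> r2" for x
  proof -
    \<comment> \<open>The representative of \<open>x\<close> in the turn covered by that
      arc.\<close>
    define c where "c = (if coord x < 1 / 2 then coord x + 1 else coord x)"
    have "1 / 2 \<le> c" "c \<le> 3 / 2" using coord_bounds[of x] by (auto simp: c_def)
    then obtain s where s: "r0 \<le> s" "s \<le> r2" "G s = c"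
      using IVT'[of G r0 c r2] Gc[of r0 r2] r0 r2 \<open>r0 \<le> r2\<close> by auto
    have "frac s = s" using s r0 \<open>r2 < 1\<close> by (simp add: frac_eq)
    then have "coord (circle_of s) = s" by (simp add: coord_circle_of)
    moreover have "circle_of c = x"
      using circle_of_add_of_int[of "coord x" 1] by (simp add: c_def)
    ultimately have "T (circle_of s) = x" using s by (simp add: circle_map_eq G_def)
    then show ?thesis using s \<open>coord (circle_of s) = s\<close> by metis
  qed
  \<comment> \<open>Coordinates within \<open>a\<close> of the arc are still at least
    \<open>a\<close>, hence the expansion factor there is at least \<open>1 + V a\<close>.\<close>
  define a where "a = r0 / 2"
  have a: "0 < a" using \<open>0 < r0\<close> by (simp add: a_def)
  have Va: "0 < V a" using V_less[of 0 a] V_nonneg[of 0] a by simp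
  have "uniformly_continuous_on {0..1} G" using Gc by (intro compact_uniformly_continuous) auto
  then obtain d1 where d1: "0 < d1" "\<And>s t. s \<in> {0..1} \<Longrightarrow> t \<in> {0..1} \<Longrightarrow> dist t s < d1 \<Longrightarrow>
      dist (G t) (G s) < 1 / 2"
    unfolding uniformly_continuous_on_def by (metis half_gt_zero_iff zero_less_one)
  \<comment> \<open>\<open>a\<close> and \<open>1 - r2\<close> rule out short arcs through
    \<open>0\<close>; \<open>d1\<close> keeps images within \<open>1 / 2\<close>, where line and
    circle distances agree.\<close>
  define d where "d = min d1 (min a (1 - r2))"
  have d: "0 < d" using d1 a \<open>r2 < 1\<close> by (simp add: d_def)
  have main: "dist z w \<le> 1 / (1 + V a) * dist (T z) (T w)"
    if z: "r0 \<le> coord z" "coord z \<le> r2" and zw: "dist z w < d" for z w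
  proof -
    have zw': "dist z w = \<bar>coord z - coord w\<bar>"
      using zw z coord_bounds[of w] a unfolding dist_circle_def d_def a_def by (auto simp: min_def split: if_splits)
    then have "\<bar>coord z - coord w\<bar> < a" using zw by (simp add: d_def)
    then have wa: "a \<le> coord w" using z unfolding a_def by linarith
    have za: "a \<le> coord z" using z a by (auto simp: a_def)
    have Vmono: "V a \<le> V t" if "a \<le> t" for t
      using V_less[of a t] a that by (cases "t = a") auto
    have exp: "(1 + V a) * (t - s) \<le> G t - G s" if "a \<le> s" "s \<le> t" for s t
      using order_trans[OF mult_right_mono profile_expanding[of s t], of "1 + V a"] Vmono[of s] that a
      by (simp add: G_def)
    have "(1 + V a) * \<bar>coord z - coord w\<bar> \<le> \<bar>G (coord z) - G (coord w)\<bar>"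
    proof (cases "coord z \<le> coord w")
      case True
      then show ?thesis using exp[of "coord z" "coord w"] za by (simp add: abs_real_def)
    next
      case False
      then show ?thesis using exp[of "coord w" "coord z"] wa by (simp add: abs_real_def)
    qed
    moreover have "dist (T z) (T w) = \<bar>G (coord z) - G (coord w)\<bar>"
    proof -
      have "\<bar>G (coord z) - G (coord w)\<bar> \<le> 1 / 2"
        using d1(2)[of "coord w" "coord z"] coord_bounds[of z] coord_bounds[of w] zw zw'
        by (simp add: dist_real_def d_def)
      then show ?thesis using dist_circle_of(2) by (simp add: circle_map_eq G_def)
    qed
    ultimately have "(1 + V a) * dist z w \<le> dist (T z) (T w)" by (simp add: zw')
    then show ?thesis using Va by (simp add: field_simps)
  qed
  show ?thesis
  proof (rule that[of "1 / (1 + V a)" d])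
    fix x
    obtain z where "T z = x" "r0 \<le> coord z" "coord z \<le> r2" using pre by blast
    then show "\<exists>z. T z = x \<and> (\<forall>w. dist z w < d \<longrightarrow> dist z w \<le> 1 / (1 + V a) * dist x (T w))"
      using main by blast
  qed (use Va d in auto)
qed

lemma T_surj: "\<exists>z. T z = x"
  by (rule expanding_preimage) blast

end


section \<open>Transfer operators\<close>

text \<open>The bijections in \<^const>\<open>compatible\<close> relate whole pre-orbits, and a priori the first
  entry of the image may depend on the entire pre-orbit. Injectivity on the fibre is recovered from
  the separation of preimages.\<close>

lemma compatible_preimages_inj:
  fixes T :: "'a::metric_space \<Rightarrow> 'a"
  assumes surj: "\<And>x. \<exists>z. T z = x"
    and exp: "\<And>x y. dist x y < d \<Longrightarrow> dist x y \<le> dist (T x) (T y)"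
    and xy: "dist x y < d / 2"
    and \<beta>: "bij_betw \<beta> (pre_orbits T x) (pre_orbits T y)"
      "\<And>p. p \<in> pre_orbits T x \<Longrightarrow> P (p 1) (\<beta> p 1) \<and> dist (p 1) (\<beta> p 1) \<le> dist x y"
  obtains b where "inj_on b (T -` {x})" "b \<in> T -` {x} \<rightarrow> T -` {y}"
    "\<And>z. z \<in> T -` {x} \<Longrightarrow> P z (b z) \<and> dist z (b z) \<le> dist x y"
proof -
  \<comment> \<open>Iterating a choice \<open>e\<close> of preimages extends \<open>z\<close> to a
    pre-orbit of \<open>x\<close> through \<open>z\<close>.\<close>
  obtain e where e: "\<And>w. T (e w) = w" using surj by metis
  define orb where "orb = (\<lambda>z k. case k of 0 \<Rightarrow> x | Suc j \<Rightarrow> (e ^^ j) z)"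
  have orb: "orb z \<in> pre_orbits T x" "orb z 1 = z" if "T z = x" for z
    using that e by (auto simp: orb_def pre_orbits_def split: nat.split)
  define b where "b = (\<lambda>z. \<beta> (orb z) 1)"
  have b: "P z (b z) \<and> dist z (b z) \<le> dist x y" "T (b z) = y" if z: "T z = x" for z
  proof -
    have "\<beta> (orb z) \<in> pre_orbits T y" using orb(1)[OF z] \<beta>(1) by (auto simp: bij_betw_def)
    then show "T (b z) = y" by (auto simp: b_def pre_orbits_def)
    show "P z (b z) \<and> dist z (b z) \<le> dist x y"
      using \<beta>(2)[OF orb(1)[OF z]] orb(2)[OF z] by (simp add: b_def)
  qed
  have "inj_on b (T -` {x})"
  proof (rule inj_onI)
    fix z w assume zw: "z \<in> T -` {x}" "w \<in> T -` {x}" "b z = b w"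
    \<comment> \<open>Two preimages with the same partner are less than \<open>d\<close> apart; at
      that scale \<open>T\<close> does not shrink distances, yet both map to
      \<open>x\<close>.\<close>
    have "dist z w \<le> dist z (b z) + dist w (b w)"
      using dist_triangle2[of z w "b z"] zw(3) by simp
    then have "dist z w < d" using b(1)[of z] b(1)[of w] zw xy by simp
    from exp[OF this] show "z = w" using zw by simp
  qed
  with that[of b] b show ?thesis by auto
qed

text \<open>The first entries of pre-orbits give injections between fibres in both directions.
  Finite fibres then have equal size, so each injection is a bijection.\<close>

lemma compatible_preimage_pairing:
  fixes T :: "'a::metric_space \<Rightarrow> 'a"
  assumes comp: "compatible T \<Omega> \<omega>"
    and surj: "\<And>x. \<exists>z. T z = x" and fin: "\<And>x. finite (T -` {x})"
    and d: "0 < d" and exp: "\<And>x y. dist x y < d \<Longrightarrow> dist x y \<le> dist (T x) (T y)"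
  obtains r C where "0 < r" "0 < C" "\<And>x y. dist x y < r \<Longrightarrow> \<exists>b. bij_betw b (T -` {x}) (T -` {y}) \<and>
    (\<forall>z\<in>T -` {x}. dist z (b z) \<le> dist x y \<and> C * \<omega> (dist z (b z)) \<le> \<Omega> (dist x y) - \<Omega> (dist z (b z)))"
proof -
  obtain r1 C where "0 < r1" "0 < C" and pre: "\<And>x y. dist x y < r1 \<Longrightarrow>
      \<exists>\<beta>. bij_betw \<beta> (pre_orbits T x) (pre_orbits T y) \<and>
        (\<forall>p\<in>pre_orbits T x. \<forall>k. dist (p k) (\<beta> p k) \<le> dist x y \<and>
           C * (\<Sum>j=1..k. \<omega> (dist (p j) (\<beta> p j))) \<le> \<Omega> (dist x y) - \<Omega> (dist (p k) (\<beta> p k)))"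
    using comp unfolding compatible_def by blast
  define r where "r = min r1 (d / 2)"
  define P where "P = (\<lambda>(x::'a) y z w. C * \<omega> (dist z w) \<le> \<Omega> (dist x y) - \<Omega> (dist z (w::'a)))"
  have step: "\<exists>b. inj_on b (T -` {x}) \<and> b \<in> T -` {x} \<rightarrow> T -` {y} \<and>
      (\<forall>z\<in>T -` {x}. P x y z (b z) \<and> dist z (b z) \<le> dist x y)" if xy: "dist x y < r" for x y
  proof -
    obtain \<beta> where \<beta>: "bij_betw \<beta> (pre_orbits T x) (pre_orbits T y)"
      "\<And>p k. p \<in> pre_orbits T x \<Longrightarrow> dist (p k) (\<beta> p k) \<le> dist x y \<and>
           C * (\<Sum>j=1..k. \<omega> (dist (p j) (\<beta> p j))) \<le> \<Omega> (dist x y) - \<Omega> (dist (p k) (\<beta> p k))"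
      using pre[of x y] xy unfolding r_def by auto
    \<comment> \<open>At \<open>k = 1\<close> the compatibility sum has a single term.\<close>
    have near: "P x y (p 1) (\<beta> p 1) \<and> dist (p 1) (\<beta> p 1) \<le> dist x y" if "p \<in> pre_orbits T x" for p
      using \<beta>(2)[OF that, of 1] by (simp add: P_def)
    have "dist x y < d / 2" using xy by (simp add: r_def)
    note inj = compatible_preimages_inj[where P = "P x y" and \<beta> = \<beta>, OF surj exp this \<beta>(1) near]
    show ?thesis by (rule inj) blast+
  qed
  have "\<exists>b. bij_betw b (T -` {x}) (T -` {y}) \<and>
    (\<forall>z\<in>T -` {x}. dist z (b z) \<le> dist x y \<and> C * \<omega> (dist z (b z)) \<le> \<Omega> (dist x y) - \<Omega> (dist z (b z)))"
    if xy: "dist x y < r" for x y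
  proof -
    obtain b where b: "inj_on b (T -` {x})" "b \<in> T -` {x} \<rightarrow> T -` {y}"
      "\<forall>z\<in>T -` {x}. P x y z (b z) \<and> dist z (b z) \<le> dist x y" using step[OF xy] by blast
    obtain b' where b': "inj_on b' (T -` {y})" "b' \<in> T -` {y} \<rightarrow> T -` {x}"
      using step[of y x] xy by (metis dist_commute)
    have "card (T -` {y}) \<le> card (b ` (T -` {x}))"
      using card_inj_on_le[OF b'(1) _ fin] b' card_image[OF b(1)] by auto
    then have "b ` (T -` {x}) = T -` {y}"
      using b(2) by (intro card_seteq fin) auto
    then show ?thesis using b by (auto simp: bij_betw_def P_def)
  qed
  then show ?thesis using that[of r C] \<open>0 < r1\<close> \<open>0 < C\<close> d by (auto simp: r_def)
qed

section \<open>Estimates for weights and algebra of transfer operators\<close>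

text \<open>The factor \<open>exp s\<close> is kept so that the errors can be summed over a fibre,
  where the weights add up to one.\<close>

lemma abs_exp_diff_le: "\<bar>exp s - exp t\<bar> \<le> exp s * (\<bar>t - s\<bar> * exp \<bar>t - s\<bar>)" for s t :: real
proof -
  have key: "\<bar>1 - exp u\<bar> \<le> \<bar>u\<bar> * exp \<bar>u\<bar>" for u :: real
  proof (cases "0 \<le> u")
    case True
    have "exp u * (1 - u) \<le> exp u * exp (- u)"
      using exp_ge_add_one_self[of "- u"] by (intro mult_left_mono) auto
    then have "exp u - 1 \<le> u * exp u" by (simp add: algebra_simps flip: exp_add)
    then show ?thesis using True by simp
  next
    case False
    have "1 - exp u \<le> - u" using exp_ge_add_one_self[of u] by linarith
    also have "\<dots> \<le> - u * exp (- u)" using False by simp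
    finally show ?thesis using False by simp
  qed
  have "exp s - exp t = exp s * (1 - exp (t - s))" by (simp add: exp_diff algebra_simps)
  then show ?thesis using key[of "t - s"] by (simp add: abs_mult)
qed

lemma abs_ln_diff_le:
  fixes a b m :: real
  assumes "0 < m" "m \<le> a" "m \<le> b"
  shows "\<bar>ln a - ln b\<bar> \<le> \<bar>a - b\<bar> / m"
proof -
  have *: "ln a - ln b \<le> \<bar>a - b\<bar> / m" if "m \<le> a" "m \<le> b" for a b
  proof -
    have "ln a - ln b = ln (a / b)" using that assms(1) by (simp add: ln_div)
    also have "\<dots> \<le> a / b - 1" using that assms(1) by (intro ln_le_minus_one) auto
    also have "\<dots> = (a - b) / b" using that assms(1) by (simp add: diff_divide_distrib)
    also have "\<dots> \<le> \<bar>a - b\<bar> / m" using that assms(1) by (intro frac_le) auto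
    finally show ?thesis .
  qed
  show ?thesis using *[of a b] *[of b a] assms by (simp add: abs_le_iff abs_minus_commute)
qed

lemma transfer_operator_scale:
  "transfer_operator T f (\<lambda>x. a * \<phi> x) = (\<lambda>x. a * transfer_operator T f \<phi> x)"
  by (auto simp: transfer_operator_def sum_distrib_left mult_ac)

lemma transfer_operator_diff:
  "transfer_operator T f (\<lambda>x. \<phi> x - \<psi> x) = (\<lambda>x. transfer_operator T f \<phi> x - transfer_operator T f \<psi> x)"
  by (auto simp: transfer_operator_def sum_subtractf right_diff_distrib)

text \<open>A function of \<open>T y\<close> is constant on each fibre and leaves the sum.\<close>

lemma transfer_operator_comp:
  "transfer_operator T f (\<lambda>y. \<phi> y * \<psi> (T y)) x = \<psi> x * transfer_operator T f \<phi> x"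
  by (auto simp: transfer_operator_def sum_distrib_left mult_ac intro!: sum.cong)

lemma transfer_operator_bound:
  assumes "transfer_operator T g (\<lambda>_. 1) x = 1" "\<And>x. \<bar>\<phi> x\<bar> \<le> S"
  shows "\<bar>transfer_operator T g \<phi> x\<bar> \<le> S"
proof -
  have "\<bar>transfer_operator T g \<phi> x\<bar> \<le> (\<Sum>y\<in>T -` {x}. exp (g y) * \<bar>\<phi> y\<bar>)"
    unfolding transfer_operator_def by (rule sum_abs[THEN order_trans]) (simp add: abs_mult)
  also have "\<dots> \<le> (\<Sum>y\<in>T -` {x}. exp (g y) * S)" by (intro sum_mono) (simp add: assms(2))
  also have "\<dots> = S" using assms(1) by (simp add: transfer_operator_def flip: sum_distrib_right)
  finally show ?thesis .
qed

section \<open>The Lasota--Yorke inequality\<close>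

text \<open>Passing from \<open>x\<close> to \<open>y\<close> changes values and weights. The
  weights sum to one, so the values contribute at most \<open>A * \<Omega> (dist x y)\<close>; the
  contracted pair, of weight at least \<open>\<gamma>\<close>, saves the share
  \<open>\<gamma> * c\<close> of it. The change of weights costs a multiple of
  \<open>S\<close>.\<close>

lemma transfer_operator_lasota_yorke:
  fixes T :: "'a::metric_space \<Rightarrow> 'a"
  assumes mod: "modulus_of_continuity \<Omega>" and fin: "\<And>x. finite (T -` {x})"
    and norm: "\<And>x. transfer_operator T g (\<lambda>_. 1) x = 1"
    and pair: "\<And>x y. dist x y < r \<Longrightarrow> \<exists>b. bij_betw b (T -` {x}) (T -` {y}) \<and>
      (\<forall>z\<in>T -` {x}. dist z (b z) \<le> dist x y \<and> \<bar>g (b z) - g z\<bar> \<le> D * \<Omega> (dist x y)) \<and>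
      (\<exists>z\<in>T -` {x}. \<Omega> (dist z (b z)) \<le> (1 - c) * \<Omega> (dist x y))"
    and \<gamma>: "\<And>x. \<gamma> \<le> exp (g x)" and c: "0 \<le> c" and D: "0 \<le> D"
    and A: "0 \<le> A" "locally_modulus r \<Omega> A \<phi>" and S: "\<And>x. \<bar>\<phi> x\<bar> \<le> S"
  shows "locally_modulus r \<Omega> ((1 - \<gamma> * c) * A + D * exp (D * \<Omega> r) * S) (transfer_operator T g \<phi>)"
  unfolding locally_modulus_def
proof (intro allI impI)
  fix x y :: 'a assume xy: "dist x y < r"
  define W where "W = \<Omega> (dist x y)"
  have W: "0 \<le> W" "W \<le> \<Omega> r"
    using modulus_nonneg[OF mod] modulus_mono[OF mod] xy by (auto simp: W_def)
  have S0: "0 \<le> S" using S[of undefined] by linarith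
  obtain b w where b: "bij_betw b (T -` {x}) (T -` {y})"
    and bz: "\<And>z. z \<in> T -` {x} \<Longrightarrow> dist z (b z) \<le> dist x y \<and> \<bar>g (b z) - g z\<bar> \<le> D * W"
    and w: "w \<in> T -` {x}" "\<Omega> (dist w (b w)) \<le> (1 - c) * W"
    using pair[OF xy] unfolding W_def by blast
  have one: "(\<Sum>z\<in>T -` {x}. exp (g z)) = 1" using norm[of x] by (simp add: transfer_operator_def)
  \<comment> \<open>The subtracted term records the saving at the contracted pair \<open>w\<close>;
    in the sum over the fibre it occurs once.\<close>
  have summand: "\<bar>exp (g z) * \<phi> z - exp (g (b z)) * \<phi> (b z)\<bar> \<le>
      exp (g z) * (A * W + D * exp (D * \<Omega> r) * S * W) - (if z = w then A * (\<gamma> * c * W) else 0)"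
    if z: "z \<in> T -` {x}" for z
  proof -
    have "\<bar>exp (g z) * \<phi> z - exp (g (b z)) * \<phi> (b z)\<bar>
        = \<bar>exp (g z) * (\<phi> z - \<phi> (b z)) + (exp (g z) - exp (g (b z))) * \<phi> (b z)\<bar>"
      by (simp add: algebra_simps)
    also have "\<dots> \<le> exp (g z) * \<bar>\<phi> z - \<phi> (b z)\<bar> + \<bar>exp (g z) - exp (g (b z))\<bar> * \<bar>\<phi> (b z)\<bar>"
      by (rule abs_triangle_ineq[THEN order_trans]) (simp add: abs_mult)
    also have "\<dots> \<le> exp (g z) * (A * \<Omega> (dist z (b z))) + exp (g z) * (D * W * exp (D * \<Omega> r)) * S"
    proof (intro add_mono mult_mono)
      show "\<bar>\<phi> z - \<phi> (b z)\<bar> \<le> A * \<Omega> (dist z (b z))"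
        using A(2) bz[OF z] xy by (auto simp: locally_modulus_def)
      have "\<bar>g (b z) - g z\<bar> * exp \<bar>g (b z) - g z\<bar> \<le> D * W * exp (D * \<Omega> r)"
      proof (intro mult_mono)
        \<comment> \<open>\<open>\<Omega> r\<close> bounds the exponent uniformly in
          \<open>x\<close> and \<open>y\<close>.\<close>
        have "D * W \<le> D * \<Omega> r" using W D by (intro mult_left_mono)
        then show "exp \<bar>g (b z) - g z\<bar> \<le> exp (D * \<Omega> r)" using bz[OF z] by simp
      qed (use bz[OF z] W D in auto)
      then show "\<bar>exp (g z) - exp (g (b z))\<bar> \<le> exp (g z) * (D * W * exp (D * \<Omega> r))"
        by (intro order_trans[OF abs_exp_diff_le] mult_left_mono) auto
    qed (use S W D in auto)
    also have "\<dots> \<le> exp (g z) * (A * W) - (if z = w then A * (\<gamma> * c * W) else 0)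
        + exp (g z) * (D * W * exp (D * \<Omega> r)) * S"
    proof -
      have "exp (g z) * (A * \<Omega> (dist z (b z))) \<le> exp (g z) * (A * W)"
        using modulus_mono[OF mod] bz[OF z] A(1) by (intro mult_left_mono) (auto simp: W_def)
      moreover have "exp (g w) * (A * \<Omega> (dist w (b w))) \<le> exp (g w) * (A * W) - A * (\<gamma> * c * W)"
      proof -
        have "exp (g w) * (A * \<Omega> (dist w (b w))) \<le> exp (g w) * (A * ((1 - c) * W))"
          using w(2) A(1) by (intro mult_left_mono) auto
        also have "\<dots> = exp (g w) * (A * W) - exp (g w) * (A * c * W)" by (simp add: algebra_simps)
        also have "\<dots> \<le> exp (g w) * (A * W) - \<gamma> * (A * c * W)"
          using \<gamma>[of w] A(1) c W by (intro diff_left_mono mult_right_mono) auto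
        finally show ?thesis by (simp add: mult_ac)
      qed
      ultimately show ?thesis by simp
    qed
    finally show ?thesis by (simp add: algebra_simps)
  qed
  have "\<bar>transfer_operator T g \<phi> x - transfer_operator T g \<phi> y\<bar>
      = \<bar>\<Sum>z\<in>T -` {x}. exp (g z) * \<phi> z - exp (g (b z)) * \<phi> (b z)\<bar>"
    unfolding transfer_operator_def sum_subtractf
    by (simp add: sum.reindex_bij_betw[OF b, of "\<lambda>z. exp (g z) * \<phi> z"])
  also have "\<dots> \<le> (\<Sum>z\<in>T -` {x}. exp (g z) * (A * W + D * exp (D * \<Omega> r) * S * W)
      - (if z = w then A * (\<gamma> * c * W) else 0))"
    by (rule sum_abs[THEN order_trans]) (intro sum_mono summand)
  also have "\<dots> = A * W + D * exp (D * \<Omega> r) * S * W - A * (\<gamma> * c * W)"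
    using fin w(1) by (simp add: sum_subtractf one flip: sum_distrib_right)
  finally show "\<bar>transfer_operator T g \<phi> x - transfer_operator T g \<phi> y\<bar>
      \<le> ((1 - \<gamma> * c) * A + D * exp (D * \<Omega> r) * S) * \<Omega> (dist x y)"
    by (simp add: W_def algebra_simps)
qed

section \<open>The normalised transfer operator and its duality\<close>

locale rpf_system =
  fixes T :: "'a::metric_space \<Rightarrow> 'a" and \<Omega> f \<kappa> h \<nu>
  assumes rpf: "rpf_data T \<Omega> f \<kappa> h \<nu>"
    and compact_space: "compact (UNIV :: 'a set)"
    and f_continuous: "continuous_on UNIV f"
    and T_continuous: "continuous_on UNIV T"
begin

definition \<mu> :: "'a measure" where "\<mu> = density \<nu> (\<lambda>x. ennreal (h x))"

definition g :: "'a \<Rightarrow> real" where "g y = f y + ln (h y) - ln (h (T y)) - ln \<kappa>"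

abbreviation L :: "('a \<Rightarrow> real) \<Rightarrow> 'a \<Rightarrow> real" where "L \<equiv> transfer_operator T g"

lemma \<kappa>_pos: "0 < \<kappa>" and h_pos: "0 < h x" and sets_\<nu>: "sets \<nu> = sets borel" and prob_\<nu>: "prob_space \<nu>"
  and h_continuous: "continuous_on UNIV h"
  using rpf by (auto simp: rpf_data_def modulus_space_def)

lemma h_lower_bound: obtains m where "0 < m" "\<And>x. m \<le> h x"
  using continuous_attains_inf[OF compact_space _ h_continuous] h_pos by (metis UNIV_I UNIV_not_empty)

lemma continuous_bounded:
  fixes u :: "'a \<Rightarrow> real"
  assumes "continuous_on UNIV u"
  obtains S where "0 \<le> S" "\<And>x. \<bar>u x\<bar> \<le> S"
proof -
  have "bounded (range u)"
    using compact_continuous_image[OF assms compact_space] by (rule compact_imp_bounded)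
  then obtain S where "\<And>x. \<bar>u x\<bar> \<le> S" by (auto simp: bounded_iff)
  moreover from this[of undefined] have "0 \<le> S" by linarith
  ultimately show ?thesis using that by blast
qed

lemma g_continuous: "continuous_on UNIV g"
proof -
  have "continuous_on UNIV (\<lambda>y. f y + ln (h y) - ln (h (T y)) - ln \<kappa>)"
    using h_pos[THEN less_imp_neq] \<kappa>_pos
    by (intro continuous_intros f_continuous h_continuous
        continuous_on_compose2[OF h_continuous T_continuous]) (auto dest: sym)
  then show ?thesis by (simp add: g_def[abs_def])
qed

text \<open>On the fibre over \<open>x\<close> the term \<open>h (T y)\<close> in \<open>g\<close>
  equals \<open>h x\<close>, so multiplication by \<open>h\<close> conjugates \<open>L\<close> to
  the operator of \<open>f\<close> divided by \<open>\<kappa>\<close>.\<close>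

lemma transfer_operator_eq: "transfer_operator T f (\<lambda>y. h y * \<phi> y) = (\<lambda>x. \<kappa> * (h x * L \<phi> x))"
proof
  fix x
  have "exp (f y) * (h y * \<phi> y) = \<kappa> * (h x * (exp (g y) * \<phi> y))" if "y \<in> T -` {x}" for y
    using that h_pos[of y] h_pos[of x] \<kappa>_pos
    by (simp add: g_def exp_add exp_diff)
  then show "transfer_operator T f (\<lambda>y. h y * \<phi> y) x = \<kappa> * (h x * L \<phi> x)"
    unfolding transfer_operator_def sum_distrib_left by (intro sum.cong refl)
qed

lemma L_one: "L (\<lambda>_. 1) = (\<lambda>_. 1)"
proof
  fix x
  have "transfer_operator T f (\<lambda>y. h y * 1) x = \<kappa> * h x"
    using rpf by (simp add: rpf_data_def)
  then show "L (\<lambda>_. 1) x = 1" using \<kappa>_pos h_pos[of x] unfolding transfer_operator_eq by simp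
qed

lemma L_const: "L (\<lambda>_. a) = (\<lambda>_. a)"
  using transfer_operator_scale[of T g a "\<lambda>_. 1"] by (simp add: L_one)

lemma L_const_pow: "(L ^^ n) (\<lambda>_. a) = (\<lambda>_. a)"
  by (induction n) (auto simp: L_const)

lemma transfer_operator_pow_eq:
  "(transfer_operator T f ^^ n) (\<lambda>y. h y * \<phi> y) = (\<lambda>x. \<kappa> ^ n * (h x * (L ^^ n) \<phi> x))"
  by (induction n) (auto simp: transfer_operator_scale transfer_operator_eq)

lemma continuous_measurable: "continuous_on UNIV u \<Longrightarrow> u \<in> borel_measurable \<nu>" for u :: "'a \<Rightarrow> real"
  using measurable_cong_sets[OF sets_\<nu> refl] borel_measurable_continuous_onI by blast

lemma integral_\<mu>: "continuous_on UNIV u \<Longrightarrow> (\<integral>x. u x \<partial>\<mu>) = (\<integral>x. h x * u x \<partial>\<nu>)" for u :: "'a \<Rightarrow> real"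
  unfolding \<mu>_def using h_pos
  by (intro integral_real_density continuous_measurable h_continuous) (auto simp: less_imp_le)

text \<open>The known convergence, applied to the product of \<open>h\<close> and
  \<open>\<phi>\<close>, is divided by \<open>h\<close>; uniformity survives because
  \<open>h\<close> has a positive lower bound \<open>m\<close>.\<close>

lemma L_pow_limit:
  assumes "continuous_on UNIV \<phi>"
  shows "uniform_limit UNIV (\<lambda>n. (L ^^ n) \<phi>) (\<lambda>_. \<integral>x. \<phi> x \<partial>\<mu>) sequentially"
proof (rule uniform_limitI)
  fix e :: real assume "0 < e"
  obtain m where m: "0 < m" "\<And>x. m \<le> h x" by (rule h_lower_bound) blast
  define I where "I = (\<integral>x. \<phi> x \<partial>\<mu>)"
  have "uniform_limit UNIV (\<lambda>n x. (transfer_operator T f ^^ n) (\<lambda>y. h y * \<phi> y) x / \<kappa> ^ n)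
          (\<lambda>x. h x * (\<integral>y. h y * \<phi> y \<partial>\<nu>)) sequentially"
    using rpf assms h_continuous unfolding rpf_data_def by (auto intro!: continuous_intros)
  then have "uniform_limit UNIV (\<lambda>n x. h x * (L ^^ n) \<phi> x) (\<lambda>x. h x * I) sequentially"
    using \<kappa>_pos by (simp add: transfer_operator_pow_eq integral_\<mu>[OF assms] I_def)
  from uniform_limitD[OF this, of "m * e"]
  have "\<forall>\<^sub>F n in sequentially. \<forall>x. \<bar>h x * (L ^^ n) \<phi> x - h x * I\<bar> < m * e"
    using m \<open>0 < e\<close> by (simp add: dist_real_def)
  then show "\<forall>\<^sub>F n in sequentially. \<forall>x\<in>UNIV. dist ((L ^^ n) \<phi> x) I < e"
  proof (rule eventually_mono, intro ballI)
    fix n x assume "\<forall>x. \<bar>h x * (L ^^ n) \<phi> x - h x * I\<bar> < m * e"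
    then have "\<bar>h x * ((L ^^ n) \<phi> x - I)\<bar> < m * e" by (simp add: right_diff_distrib)
    then have "h x * \<bar>(L ^^ n) \<phi> x - I\<bar> < m * e" using h_pos[of x] by (simp add: abs_mult)
    moreover have "m * \<bar>(L ^^ n) \<phi> x - I\<bar> \<le> h x * \<bar>(L ^^ n) \<phi> x - I\<bar>"
      using m by (intro mult_right_mono) auto
    ultimately have "m * \<bar>(L ^^ n) \<phi> x - I\<bar> < m * e" by linarith
    then show "dist ((L ^^ n) \<phi> x) I < e" using m by (simp add: dist_real_def)
  qed
qed

text \<open>The eigenmeasure equation is applied to the product of \<open>h\<close>,
  \<open>u\<close> and \<open>v \<circ> T\<close>; the last factor leaves the operator and
  \<open>\<kappa>\<close> cancels.\<close>

lemma duality: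
  assumes "continuous_on UNIV u" "continuous_on UNIV v" "continuous_on UNIV (L u)"
  shows "(\<integral>x. u x * v (T x) \<partial>\<mu>) = (\<integral>x. v x * L u x \<partial>\<mu>)"
proof -
  have cvT: "continuous_on UNIV (\<lambda>x. v (T x))"
    by (rule continuous_on_compose2[OF assms(2) T_continuous]) auto
  have "\<kappa> * (\<integral>x. u x * v (T x) \<partial>\<mu>) = \<kappa> * (\<integral>x. (h x * u x) * v (T x) \<partial>\<nu>)"
    by (simp add: integral_\<mu> continuous_on_mult assms cvT mult.assoc)
  also have "\<dots> = (\<integral>x. transfer_operator T f (\<lambda>x. (h x * u x) * v (T x)) x \<partial>\<nu>)"
    using rpf assms h_continuous cvT unfolding rpf_data_def by (simp add: continuous_on_mult)
  also have "\<dots> = (\<integral>x. \<kappa> * (h x * (v x * L u x)) \<partial>\<nu>)"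
    by (simp add: transfer_operator_comp transfer_operator_eq mult_ac)
  also have "\<dots> = \<kappa> * (\<integral>x. v x * L u x \<partial>\<mu>)"
    by (simp add: integral_\<mu> continuous_on_mult assms)
  finally show ?thesis using \<kappa>_pos by simp
qed

lemma duality_pow:
  assumes "\<And>n. continuous_on UNIV ((L ^^ n) u)" "continuous_on UNIV v"
  shows "(\<integral>x. u x * v ((T ^^ n) x) \<partial>\<mu>) = (\<integral>x. v x * (L ^^ n) u x \<partial>\<mu>)"
  using assms(2)
\<comment> \<open>The induction hypothesis is used for \<open>v \<circ> T\<close>; one more
  application of duality removes the remaining \<open>T\<close>.\<close>
proof (induction n arbitrary: v)
  case (Suc n)
  have "continuous_on UNIV (\<lambda>x. v (T x))"
    by (rule continuous_on_compose2[OF Suc.prems T_continuous]) auto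
  from Suc.IH[OF this] have "(\<integral>x. u x * v ((T ^^ Suc n) x) \<partial>\<mu>) = (\<integral>x. (L ^^ n) u x * v (T x) \<partial>\<mu>)"
    by (simp add: mult.commute)
  also have "\<dots> = (\<integral>x. v x * (L ^^ Suc n) u x \<partial>\<mu>)"
    using duality[OF assms(1)[of n] Suc.prems] assms(1)[of "Suc n"] by simp
  finally show ?case .
qed (simp add: mult.commute)

lemma prob_\<mu>: "prob_space \<mu>"
proof
  interpret prob_space \<nu> by (rule prob_\<nu>)
  have hm: "h \<in> borel_measurable \<nu>" by (rule continuous_measurable[OF h_continuous])
  \<comment> \<open>A non-integrable function has integral \<open>0\<close> by convention, against
    the normalisation to \<open>1\<close>.\<close>
  have "integrable \<nu> h"
  proof (rule ccontr)
    assume "\<not> integrable \<nu> h"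
    then show False using rpf not_integrable_integral_eq by (force simp: rpf_data_def)
  qed
  then have "(\<integral>\<^sup>+x. ennreal (h x) \<partial>\<nu>) = ennreal 1"
    using rpf h_pos by (subst nn_integral_eq_integral) (auto simp: rpf_data_def less_imp_le)
  then show "emeasure \<mu> (space \<mu>) = 1"
    unfolding \<mu>_def using hm by (simp add: emeasure_density cong: nn_integral_cong)
qed

lemma integrable_\<mu>:
  fixes u :: "'a \<Rightarrow> real"
  assumes "continuous_on UNIV u"
  shows "integrable \<mu> u"
proof -
  interpret prob_space \<mu> by (rule prob_\<mu>)
  obtain S where "\<And>x. \<bar>u x\<bar> \<le> S" using continuous_bounded[OF assms] by blast
  moreover have "u \<in> borel_measurable \<mu>"
    using continuous_measurable[OF assms] by (simp add: \<mu>_def)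
  ultimately show ?thesis by (intro integrable_const_bound[where B = S]) auto
qed

lemma abs_integral_\<mu>_le:
  fixes u :: "'a \<Rightarrow> real"
  assumes "continuous_on UNIV u" "\<And>x. \<bar>u x\<bar> \<le> S"
  shows "\<bar>\<integral>x. u x \<partial>\<mu>\<bar> \<le> S"
proof -
  interpret prob_space \<mu> by (rule prob_\<mu>)
  have "\<bar>\<integral>x. u x \<partial>\<mu>\<bar> \<le> (\<integral>x. \<bar>u x\<bar> \<partial>\<mu>)" by (rule integral_abs_bound)
  also have "\<dots> \<le> S" using integrable_\<mu>[OF assms(1)] assms(2)
    by (intro integral_le_const integrable_abs) auto
  finally show ?thesis .
qed

end

section \<open>Exponential decay of correlations\<close>

lemma (in rpf_system) exponential_mixing:
  assumes "markov_lasota_yorke L \<Omega> r \<theta> B"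
  obtains \<rho> where "0 < \<rho>" "\<rho> < 1"
    "\<And>\<phi> \<psi>. \<phi> \<in> modulus_space \<Omega> \<Longrightarrow> continuous_on UNIV \<psi> \<Longrightarrow>
      \<exists>K>0. \<forall>n. \<bar>(\<integral>x. \<phi> x * \<psi> ((T ^^ n) x) \<partial>\<mu>) - (\<integral>x. \<phi> x \<partial>\<mu>) * (\<integral>x. \<psi> x \<partial>\<mu>)\<bar> \<le> K * \<rho> ^ n"
proof -
  interpret M: markov_lasota_yorke L \<Omega> r \<theta> B by (rule assms)
  obtain \<rho> where \<rho>: "0 < \<rho>" "\<rho> < 1" and decay: "\<And>A \<phi>. 0 \<le> A \<Longrightarrow> locally_modulus r \<Omega> A \<phi> \<Longrightarrow>
       uniform_limit UNIV (\<lambda>n. (L ^^ n) \<phi>) (\<lambda>_. 0) sequentially \<Longrightarrow>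
       \<exists>K>0. \<forall>n x. \<bar>(L ^^ n) \<phi> x\<bar> \<le> K * \<rho> ^ n"
    using M.exponential_decay by blast
  have "\<exists>K>0. \<forall>n. \<bar>(\<integral>x. \<phi> x * \<psi> ((T ^^ n) x) \<partial>\<mu>) - (\<integral>x. \<phi> x \<partial>\<mu>) * (\<integral>x. \<psi> x \<partial>\<mu>)\<bar> \<le> K * \<rho> ^ n"
    if \<phi>: "\<phi> \<in> modulus_space \<Omega>" and \<psi>: "continuous_on UNIV \<psi>" for \<phi> \<psi>
  proof -
    define I where "I = (\<integral>x. \<phi> x \<partial>\<mu>)"
    have \<phi>c: "continuous_on UNIV \<phi>" using \<phi> by (simp add: modulus_space_def)
    obtain A where A: "0 \<le> A" "\<And>x y. \<bar>\<phi> x - \<phi> y\<bar> \<le> A * \<Omega> (dist x y)"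
      using modulus_space_bound[OF M.modulus \<phi>] by blast
    obtain S where S: "0 \<le> S" "\<And>x. \<bar>\<phi> x\<bar> \<le> S" using continuous_bounded[OF \<phi>c] by blast
    obtain R where R: "0 \<le> R" "\<And>x. \<bar>\<psi> x\<bar> \<le> R" using continuous_bounded[OF \<psi>] by blast
    have pow: "(L ^^ n) (\<lambda>x. \<phi> x - I) = (\<lambda>x. (L ^^ n) \<phi> x - I)" for n
      by (simp add: M.diff_pow L_const_pow)
    \<comment> \<open>The iterated Lasota--Yorke bound makes all iterates continuous, as duality and
      integrability require.\<close>
    have cont: "continuous_on UNIV ((L ^^ n) \<phi>)" for n
    proof (rule locally_modulus_continuous[OF M.modulus M.r_pos])
      show "locally_modulus r \<Omega> (\<theta> ^ n * A + M.M * S) ((L ^^ n) \<phi>)"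
        by (rule M.lasota_yorke_pow) (use A S in \<open>auto simp: locally_modulus_def\<close>)
      show "0 \<le> \<theta> ^ n * A + M.M * S" using M.\<theta> M.M_absorbing A S by simp
    qed
    have "uniform_limit UNIV (\<lambda>n x. (L ^^ n) \<phi> x - I) (\<lambda>x. I - I) sequentially"
      using L_pow_limit[OF \<phi>c] unfolding I_def
      by (intro uniform_limit_minus uniform_limit_const)
    then have "\<exists>K>0. \<forall>n x. \<bar>(L ^^ n) (\<lambda>x. \<phi> x - I) x\<bar> \<le> K * \<rho> ^ n"
      by (intro decay[OF A(1)]) (use A in \<open>auto simp: locally_modulus_def pow\<close>)
    then obtain K where K: "0 < K" "\<And>n x. \<bar>(L ^^ n) \<phi> x - I\<bar> \<le> K * \<rho> ^ n"
      by (auto simp: pow)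
    \<comment> \<open>\<open>R + 1\<close> keeps the constant positive when
      \<open>R = 0\<close>.\<close>
    have "\<bar>(\<integral>x. \<phi> x * \<psi> ((T ^^ n) x) \<partial>\<mu>) - I * (\<integral>x. \<psi> x \<partial>\<mu>)\<bar> \<le> (R + 1) * K * \<rho> ^ n" for n
    proof -
      have "(\<integral>x. \<phi> x * \<psi> ((T ^^ n) x) \<partial>\<mu>) - I * (\<integral>x. \<psi> x \<partial>\<mu>)
          = (\<integral>x. \<psi> x * (L ^^ n) \<phi> x \<partial>\<mu>) - (\<integral>x. I * \<psi> x \<partial>\<mu>)"
        by (simp add: duality_pow cont \<psi>)
      also have "\<dots> = (\<integral>x. \<psi> x * (L ^^ n) \<phi> x - I * \<psi> x \<partial>\<mu>)"
        by (intro Bochner_Integration.integral_diff[symmetric] integrable_\<mu> continuous_intros cont \<psi>)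
      also have "\<dots> = (\<integral>x. \<psi> x * ((L ^^ n) \<phi> x - I) \<partial>\<mu>)" by (simp add: algebra_simps)
      also have "\<bar>\<dots>\<bar> \<le> (R + 1) * (K * \<rho> ^ n)"
      proof (rule abs_integral_\<mu>_le)
        show "continuous_on UNIV (\<lambda>x. \<psi> x * ((L ^^ n) \<phi> x - I))"
          by (intro continuous_intros cont \<psi>)
        show "\<bar>\<psi> x * ((L ^^ n) \<phi> x - I)\<bar> \<le> (R + 1) * (K * \<rho> ^ n)" for x
          unfolding abs_mult using R(1) R(2)[of x] K(2)[of n x] by (intro mult_mono) auto
      qed
      finally show ?thesis by (simp add: mult.assoc)
    qed
    then show ?thesis using K(1) R(1) unfolding I_def by (intro exI[of _ "(R + 1) * K"]) auto
  qed
  with that \<rho> show ?thesis by blast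
qed

theorem theorem3:
  fixes V \<omega> \<Omega> :: "real \<Rightarrow> real" and T :: "circle \<Rightarrow> circle"
    and f h :: "circle \<Rightarrow> real" and \<kappa> :: real and \<nu> \<mu> :: "circle measure"
  assumes "admissible V"
    and "T = circle_map V"
    and "modulus_of_continuity \<omega>"
    and "modulus_of_continuity \<Omega>"
    and "compatible T \<Omega> \<omega>"
    and "concave_on {0..} \<Omega>"
    and "vanishes_orderly \<Omega>"
    and "f \<in> modulus_space \<omega>"
    and "rpf_data T \<Omega> f \<kappa> h \<nu>"
    and "\<mu> = density \<nu> (\<lambda>x. ennreal (h x))"
    and "unique_equilibrium_state T f \<mu>"
  shows "\<exists>\<rho>\<in>{0<..<1::real}. \<forall>\<phi>\<in>modulus_space \<Omega>. \<forall>\<psi>\<in>modulus_space \<Omega>.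
           \<exists>K>0. \<forall>n\<ge>1.
             \<bar>(\<integral>x. \<phi> x * \<psi> ((T ^^ n) x) \<partial>\<mu>) - (\<integral>x. \<phi> x \<partial>\<mu>) * (\<integral>x. \<psi> x \<partial>\<mu>)\<bar>
               \<le> K * \<rho> ^ n"
proof -
  interpret E: expanding_circle_map V by unfold_locales (rule assms(1))
  note T = assms(2) and mod = assms(4)
  interpret R: rpf_system T \<Omega> f \<kappa> h \<nu>
    by unfold_locales
      (use assms(8,9) compact_circle E.T_continuous T in \<open>auto simp: modulus_space_def\<close>)
  have \<mu>: "\<mu> = R.\<mu>" by (simp add: R.\<mu>_def assms(10))
  obtain d where d: "0 < d" "\<And>x y. dist x y < d \<Longrightarrow> dist x y \<le> dist (T x) (T y)"
    using E.T_locally_expanding unfolding T by blast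
  have fin: "finite (T -` {x})" for x
    unfolding T by (rule finite_circle_map_preimage[OF assms(1)])
  have surj: "\<exists>z. T z = x" for x unfolding T by (rule E.T_surj)
  obtain r1 C where r1: "0 < r1" "0 < C" and pair: "\<And>x y. dist x y < r1 \<Longrightarrow> \<exists>b. bij_betw b (T -` {x}) (T -` {y}) \<and>
    (\<forall>z\<in>T -` {x}. dist z (b z) \<le> dist x y \<and> C * \<omega> (dist z (b z)) \<le> \<Omega> (dist x y) - \<Omega> (dist z (b z)))"
    using compatible_preimage_pairing[OF assms(5) surj fin d] by blast
  obtain l d2 where l: "0 < l" "l < 1" "0 < d2"
    "\<And>x. \<exists>z. T z = x \<and> (\<forall>w. dist z w < d2 \<longrightarrow> dist z w \<le> l * dist x (T w))"
    using E.expanding_preimage unfolding T by blast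
  obtain c r2 where c: "0 < c" "0 < r2"
    "\<And>d s. 0 < d \<Longrightarrow> d < r2 \<Longrightarrow> 0 \<le> s \<Longrightarrow> s \<le> l * d \<Longrightarrow> \<Omega> s \<le> (1 - c) * \<Omega> d"
    using orderly_contraction[OF mod assms(6,7), of l] l by auto
  obtain F where F: "0 \<le> F" "\<And>x y. \<bar>f x - f y\<bar> \<le> F * \<omega> (dist x y)"
    using modulus_space_bound[OF assms(3,8)] by blast
  have "h \<in> modulus_space \<Omega>" using assms(9) by (simp add: rpf_data_def)
  then obtain H where H: "0 \<le> H" "\<And>x y. \<bar>h x - h y\<bar> \<le> H * \<Omega> (dist x y)"
    using modulus_space_bound[OF mod] by blast
  obtain m where m: "0 < m" "\<And>x. m \<le> h x" using R.h_lower_bound by blast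
  obtain \<Gamma> where \<Gamma>: "\<And>x. \<bar>R.g x\<bar> \<le> \<Gamma>" using R.continuous_bounded[OF R.g_continuous] by blast
  \<comment> \<open>Along a pair, compatibility bounds the variation of \<open>f\<close> by
    \<open>F / C\<close> times \<open>\<Omega> (dist x y)\<close>; the terms \<open>ln h\<close> and
    \<open>ln (h \<circ> T)\<close> of \<open>g\<close> contribute \<open>H / m\<close>
    each.\<close>
  define D where "D = F / C + 2 * (H / m)"
  have D: "0 \<le> D" using F(1) H(1) r1 m by (simp add: D_def)
  \<comment> \<open>Below \<open>r\<close> preimages are paired, contraction of a distance by
    \<open>l\<close> yields the gain \<open>c\<close>, and the partner of the expanding preimage
    lies in the range of uniform expansion.\<close>
  define r where "r = min r1 (min r2 d2)"
  have r: "0 < r" using r1 c l by (simp add: r_def)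
  have pairing: "\<exists>b. bij_betw b (T -` {x}) (T -` {y}) \<and>
      (\<forall>z\<in>T -` {x}. dist z (b z) \<le> dist x y \<and> \<bar>R.g (b z) - R.g z\<bar> \<le> D * \<Omega> (dist x y)) \<and>
      (\<exists>z\<in>T -` {x}. \<Omega> (dist z (b z)) \<le> (1 - c) * \<Omega> (dist x y))" if xy: "dist x y < r" for x y
  proof -
    obtain b where b: "bij_betw b (T -` {x}) (T -` {y})"
      and bz: "\<And>z. z \<in> T -` {x} \<Longrightarrow> dist z (b z) \<le> dist x y \<and>
        C * \<omega> (dist z (b z)) \<le> \<Omega> (dist x y) - \<Omega> (dist z (b z))"
      using pair[of x y] xy unfolding r_def by auto
    have Tb: "T (b z) = y" if "z \<in> T -` {x}" for z using b that by (auto simp: bij_betw_def)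
    have ln_h: "\<bar>ln (h u) - ln (h v)\<bar> \<le> H / m * \<Omega> (dist x y)" if "dist u v \<le> dist x y" for u v
    proof -
      have "\<bar>ln (h u) - ln (h v)\<bar> \<le> \<bar>h u - h v\<bar> / m" by (rule abs_ln_diff_le) (use m in auto)
      also have "\<dots> \<le> H * \<Omega> (dist u v) / m" using m H(2) by (intro divide_right_mono) auto
      also have "\<dots> \<le> H * \<Omega> (dist x y) / m"
        using m H(1) modulus_mono[OF mod _ that] by (intro divide_right_mono mult_left_mono) auto
      finally show ?thesis by simp
    qed
    have "\<bar>R.g (b z) - R.g z\<bar> \<le> D * \<Omega> (dist x y)" if z: "z \<in> T -` {x}" for z
    proof -
      have "C * \<omega> (dist z (b z)) \<le> \<Omega> (dist x y)"
        using bz[OF z] modulus_nonneg[OF mod, of "dist z (b z)"] by simp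
      then have "\<omega> (dist z (b z)) \<le> \<Omega> (dist x y) / C" using r1 by (simp add: field_simps)
      then have "F * \<omega> (dist z (b z)) \<le> F * (\<Omega> (dist x y) / C)" using F(1) by (rule mult_left_mono)
      then have "\<bar>f z - f (b z)\<bar> \<le> F / C * \<Omega> (dist x y)" using F(2)[of z "b z"] by simp
      moreover have "\<bar>ln (h z) - ln (h (b z))\<bar> \<le> H / m * \<Omega> (dist x y)"
        using bz[OF z] by (intro ln_h) simp
      moreover have "\<bar>ln (h x) - ln (h y)\<bar> \<le> H / m * \<Omega> (dist x y)" by (intro ln_h) simp
      moreover have "D * \<Omega> (dist x y)
          = F / C * \<Omega> (dist x y) + H / m * \<Omega> (dist x y) + H / m * \<Omega> (dist x y)"
        unfolding D_def by (simp only: distrib_right mult_2 add.assoc)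
      moreover have "R.g (b z) - R.g z
          = - (f z - f (b z)) - (ln (h z) - ln (h (b z))) + (ln (h x) - ln (h y))"
        using z Tb[OF z] by (simp add: R.g_def)
      ultimately show ?thesis by linarith
    qed
    moreover have "\<exists>z\<in>T -` {x}. \<Omega> (dist z (b z)) \<le> (1 - c) * \<Omega> (dist x y)"
    proof -
      obtain z where z: "T z = x" "\<And>w. dist z w < d2 \<Longrightarrow> dist z w \<le> l * dist x (T w)"
        using l(4) by blast
      \<comment> \<open>The partner \<open>b z\<close> is within \<open>d2\<close> of
        \<open>z\<close> and maps to \<open>y\<close>, so expansion of \<open>T\<close> at
        \<open>z\<close> contracts this pair.\<close>
      have "dist z (b z) \<le> l * dist x y"
        using z(2)[of "b z"] bz[of z] Tb[of z] z(1) xy by (simp add: r_def)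
      \<comment> \<open>The gain is available at positive distance; for \<open>x = y\<close> both
        sides vanish.\<close>
      then have "\<Omega> (dist z (b z)) \<le> (1 - c) * \<Omega> (dist x y)"
      proof (cases "x = y")
        case True
        then show ?thesis using bz[of z] z(1) mod by (simp add: modulus_of_continuity_def)
      next
        case False
        then show ?thesis using \<open>dist z (b z) \<le> l * dist x y\<close> xy
          by (intro c(3)) (auto simp: r_def)
      qed
      then show ?thesis using z(1) by auto
    qed
    ultimately show ?thesis using b bz by blast
  qed
  \<comment> \<open>Weights are at least \<open>exp (- \<Gamma>)\<close>, and \<open>c > 0\<close>
    puts the rate below one. The maximum with \<open>0\<close> secures nonnegativity, as
    \<open>c\<close> comes without an upper bound.\<close>
  have "markov_lasota_yorke R.L \<Omega> r (max 0 (1 - exp (- \<Gamma>) * c)) (D * exp (D * \<Omega> r))"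
  proof
    show "\<bar>R.L \<phi> x\<bar> \<le> S" if "\<And>x. \<bar>\<phi> x\<bar> \<le> S" for \<phi> S x
      using R.L_one that by (intro transfer_operator_bound) metis+
    show "locally_modulus r \<Omega> (max 0 (1 - exp (- \<Gamma>) * c) * A + D * exp (D * \<Omega> r) * S) (R.L \<phi>)"
      if A: "0 \<le> A" "locally_modulus r \<Omega> A \<phi>" "\<And>x. \<bar>\<phi> x\<bar> \<le> S" for A \<phi> S
    proof (rule locally_modulus_mono[OF mod])
      have "exp (- \<Gamma>) \<le> exp (R.g x)" for x using \<Gamma>[of x] by simp
      then show "locally_modulus r \<Omega> ((1 - exp (- \<Gamma>) * c) * A + D * exp (D * \<Omega> r) * S) (R.L \<phi>)"
        using R.L_one c D A pairing by (intro transfer_operator_lasota_yorke[OF mod fin]) (auto simp: fun_eq_iff)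
      show "(1 - exp (- \<Gamma>) * c) * A + D * exp (D * \<Omega> r) * S
          \<le> max 0 (1 - exp (- \<Gamma>) * c) * A + D * exp (D * \<Omega> r) * S"
        using A by (intro add_right_mono mult_right_mono) auto
    qed
  qed (use mod r c D compact_circle in \<open>auto simp: transfer_operator_diff transfer_operator_scale\<close>)
  then obtain \<rho> where \<rho>: "0 < \<rho>" "\<rho> < 1"
    "\<And>\<phi> \<psi>. \<phi> \<in> modulus_space \<Omega> \<Longrightarrow> continuous_on UNIV \<psi> \<Longrightarrow>
      \<exists>K>0. \<forall>n. \<bar>(\<integral>x. \<phi> x * \<psi> ((T ^^ n) x) \<partial>\<mu>) - (\<integral>x. \<phi> x \<partial>\<mu>) * (\<integral>x. \<psi> x \<partial>\<mu>)\<bar> \<le> K * \<rho> ^ n"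
    unfolding \<mu> using R.exponential_mixing by blast
  show ?thesis
  proof (intro bexI[of _ \<rho>] ballI)
    fix \<phi> \<psi> :: "circle \<Rightarrow> real"
    assume "\<phi> \<in> modulus_space \<Omega>" "\<psi> \<in> modulus_space \<Omega>"
    then show "\<exists>K>0. \<forall>n\<ge>1. \<bar>(\<integral>x. \<phi> x * \<psi> ((T ^^ n) x) \<partial>\<mu>) - (\<integral>x. \<phi> x \<partial>\<mu>) * (\<integral>x. \<psi> x \<partial>\<mu>)\<bar> \<le> K * \<rho> ^ n"
      using \<rho>(3)[of \<phi> \<psi>] by (auto simp: modulus_space_def)
  qed (use \<rho> in simp)
qed

end
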